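(* Let $\mathcal{F}$ be a simple family of $n$ $x$-monotone curves in the plane, such that no $k$ members of $\mathcal{F}$ pairwise cross. Then $\chi(\mathcal{F})\le c_k\log n$, where $c_k$ is a constant that depends only on $k$.
   Context: For a family $\mathcal{F}$ of sets in the plane, the intersection graph $G(\mathcal{F})$ has vertex set $\mathcal{F}$, with two members adjacent if and only if they have nonempty intersection; $\chi(\mathcal{F})$ denotes the chromatic number of $G(\mathcal{F})$. A curve is $x$-monotone if every vertical line meets it in at most one point. A family of curves is simple if every pair of its members intersect at most once (in at most one point) and no two members are tangent, i.e. if two curves have a common interior point, they must properly cross at that point. The words "cross" and "intersect" are used interchangeably: two members cross if they have nonempty intersection, so "no $k$ members pairwise cross" means that $G(\mathcal{F})$ has no clique on $k$ vertices. *)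

theory Defs
  imports "HOL-Analysis.Analysis" "HOL-Library.Ramsey"
begin

section \<open>Intersection graphs and chromatic number\<close>

text \<open>
  Graphs are given by a vertex set and a set of two-element edges, the convention of
  \<^const>\<open>clique\<close> in \<^theory>\<open>HOL-Library.Ramsey\<close>.
\<close>

definition intersection_edges :: "'a set set \<Rightarrow> 'a set set set" where
  "intersection_edges F = {{A, B} | A B. A \<in> F \<and> B \<in> F \<and> A \<noteq> B \<and> A \<inter> B \<noteq> {}}"

definition proper_coloring :: "'v set \<Rightarrow> 'v set set \<Rightarrow> nat \<Rightarrow> ('v \<Rightarrow> nat) \<Rightarrow> bool" where
  "proper_coloring V E m f \<longleftrightarrow>
     f ` V \<subseteq> {..<m} \<and> (\<forall>u\<in>V. \<forall>v\<in>V. {u, v} \<in> E \<and> u \<noteq> v \<longrightarrow> f u \<noteq> f v)"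

text \<open>
  Meaningful for finite \<open>V\<close>, where some proper coloring exists (\<open>proper_coloring_exists\<close>).
\<close>

definition chromatic_number :: "'v set \<Rightarrow> 'v set set \<Rightarrow> nat" where
  "chromatic_number V E = (LEAST m. \<exists>f. proper_coloring V E m f)"

lemma proper_coloring_exists:
  assumes "finite V"
  shows "\<exists>f. proper_coloring V E (card V) f"
proof -
  obtain f where "bij_betw f V {0..<card V}"
    using ex_bij_betw_finite_nat[OF assms] by blast
  then have "proper_coloring V E (card V) f"
    by (auto simp: proper_coloring_def bij_betw_def inj_on_def)
  then show ?thesis by blast
qed

section \<open>Simple families of x-monotone curves\<close>

type_synonym plane = "real \<times> real"

text \<open>
  A curve is the image of an injective path, regarded as a point set.
\<close>

definition is_curve :: "plane set \<Rightarrow> bool" where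
  "is_curve C \<longleftrightarrow> (\<exists>g. arc g \<and> path_image g = C)"

definition x_monotone_curve :: "plane set \<Rightarrow> bool" where
  "x_monotone_curve C \<longleftrightarrow>
     is_curve C \<and> (\<forall>x y z. (x, y) \<in> C \<and> (x, z) \<in> C \<longrightarrow> y = z)"

text \<open>
  Points of the curve other than its two endpoints; this does not depend on the parametrization.
\<close>

definition curve_interior :: "plane set \<Rightarrow> plane set" where
  "curve_interior C = {p. \<exists>g. arc g \<and> path_image g = C \<and> p \<in> g ` {0<..<1}}"

definition below_on :: "real set \<Rightarrow> plane set \<Rightarrow> plane set \<Rightarrow> bool" where
  "below_on X C D \<longleftrightarrow> (\<forall>x\<in>X. \<forall>y z. (x, y) \<in> C \<and> (x, z) \<in> D \<longrightarrow> y < z)"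

text \<open>
  Proper crossing of two x-monotone curves at a common interior point: near the point, each
  curve passes from one side of the other to the opposite side, the two sides being ``above'' and
  ``below''. Both curves have points over a two-sided neighbourhood of the abscissa of an
  interior point, so \<open>below_on\<close> is not vacuous there.
\<close>

definition cross_properly_at :: "plane set \<Rightarrow> plane set \<Rightarrow> plane \<Rightarrow> bool" where
  "cross_properly_at C D p \<longleftrightarrow> p \<in> C \<inter> D \<and>
     (\<exists>e>0.
        below_on {fst p - e<..<fst p} C D \<and> below_on {fst p<..<fst p + e} D C \<or>
        below_on {fst p - e<..<fst p} D C \<and> below_on {fst p<..<fst p + e} C D)"

text \<open>
  A common point that is an endpoint of one of the two curves is not restricted
  by the non-tangency clause.
\<close>

definition simple_family :: "plane set set \<Rightarrow> bool" where
  "simple_family F \<longleftrightarrow>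
     pairwise (\<lambda>C D.
       (\<forall>p\<in>C \<inter> D. \<forall>q\<in>C \<inter> D. p = q) \<and>
       (\<forall>p\<in>curve_interior C \<inter> curve_interior D. cross_properly_at C D p)) F"

end

theory Submission
  imports Defs
begin

text \<open>
  A median vertical line splits the family into the curves meeting it, the curves to its left and
  the curves to its right; the last two parts do not interact, so it suffices to color the curves
  through one vertical line with a number of colors depending on \<open>k\<close> only. Cutting these
  curves at the line leaves two families of flags, that is, of curves over \<open>[0, r]\<close> growing from a
  common ground line.

  Flags are colored by induction on the clique number. The neighborhoods of single flags have
  smaller cliques. In a distance layer of large chromatic number, two crossing flags trap a
  subfamily of large chromatic number, and an independent family \<open>W\<close> of predecessors crosses all
  trapped flags. Up to reflection, either the members of \<open>W\<close> start inside the trap and act as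
  walls across it, or they intrude from below like needles. Iterating this inside the trapped
  family, one of these situations is repeated three times. Two nested systems of walls yield two
  crossing walls that both cross all but one member of a largest clique, hence a larger clique.
  For three nested systems of needles, the same argument makes all relevant needles disjoint, and
  then every clique not covered by the induction hypothesis for truncated flags is crossed by a
  single needle.
\<close>

section \<open>Colorings\<close>

text \<open>Crossing is handled through vertical order: two flags swap their order when they meet
  and keep the new order while both live, so a comparison at the end of the shorter one tells
  whether they have met.

  The obstacle is that a chromatic number says nothing about positions on the ground line. Long
  edges provide the link: cutting the ground order greedily into blocks leaves a part in which every
  edge spans a subfamily of large chromatic number. A largest clique in such a part has much room
  between its two highest members. Walls that start in this gap, and flags that come from below to a
  flag in the gap that avoids the clique, cross all members but the highest; two of them that
  crossed each other would enlarge the clique.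

  Needles come in three systems because a needle may meet a flag anywhere along it. The middle
  system decides where flags are cut, the lowest one handles flags that end before the middle needle
  arrives, and the highest one excludes flags that meet all their needles too late.

  The logarithm comes only from the median split, each round of which costs one constant
  palette.\<close>

definition colorable :: "('a \<Rightarrow> 'a \<Rightarrow> bool) \<Rightarrow> 'a set \<Rightarrow> nat \<Rightarrow> bool" where
  "colorable E A n \<longleftrightarrow> (\<exists>h. (\<forall>x\<in>A. h x < n) \<and> (\<forall>x\<in>A. \<forall>y\<in>A. E x y \<longrightarrow> h x \<noteq> (h y :: nat)))"

lemma colorableI:
  assumes "\<And>x. x \<in> A \<Longrightarrow> h x < n" "\<And>x y. x \<in> A \<Longrightarrow> y \<in> A \<Longrightarrow> E x y \<Longrightarrow> h x \<noteq> (h y :: nat)"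
  shows "colorable E A n"
  unfolding colorable_def using assms by blast

lemma colorable_empty [simp]: "colorable E {} n"
  by (rule colorableI) auto

definition pairwise_adjacent :: "('a \<Rightarrow> 'a \<Rightarrow> bool) \<Rightarrow> 'a set \<Rightarrow> bool" where
  "pairwise_adjacent E K \<longleftrightarrow> (\<forall>x\<in>K. \<forall>y\<in>K. x \<noteq> y \<longrightarrow> E x y)"

lemma colorable_mono:
  assumes "colorable E B n" "A \<subseteq> B" "n \<le> m" "\<And>x y. x \<in> A \<Longrightarrow> y \<in> A \<Longrightarrow> E' x y \<Longrightarrow> E x y"
  shows "colorable E' A m"
proof -
  obtain h where "\<forall>x\<in>B. h x < n" "\<forall>x\<in>B. \<forall>y\<in>B. E x y \<longrightarrow> h x \<noteq> h y"
    using assms(1) by (auto simp: colorable_def)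
  then have "(\<forall>x\<in>A. h x < m) \<and> (\<forall>x\<in>A. \<forall>y\<in>A. E' x y \<longrightarrow> h x \<noteq> h y)"
    using assms(2-4) by (meson order_less_le_trans subsetD)
  then show ?thesis unfolding colorable_def by blast
qed

lemma colorable_subset: "colorable E B n \<Longrightarrow> A \<subseteq> B \<Longrightarrow> colorable E A n"
  by (erule colorable_mono) auto

lemma colorable_le: "colorable E A n \<Longrightarrow> n \<le> m \<Longrightarrow> colorable E A m"
  by (erule colorable_mono) auto

lemma colorable_1_iff: "colorable E A 1 \<longleftrightarrow> (\<forall>x\<in>A. \<forall>y\<in>A. \<not> E x y)"
  by (auto simp: colorable_def)

lemma colorable_Un:
  assumes "colorable E A n" "colorable E B m"
  shows "colorable E (A \<union> B) (n + m)"
proof -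
  obtain g where g: "\<And>x. x \<in> A \<Longrightarrow> g x < n" "\<And>x y. x \<in> A \<Longrightarrow> y \<in> A \<Longrightarrow> E x y \<Longrightarrow> g x \<noteq> g y"
    using assms(1) unfolding colorable_def by blast
  obtain h where h: "\<And>x. x \<in> B \<Longrightarrow> h x < m" "\<And>x y. x \<in> B \<Longrightarrow> y \<in> B \<Longrightarrow> E x y \<Longrightarrow> h x \<noteq> h y"
    using assms(2) unfolding colorable_def by blast
  show ?thesis
  proof (rule colorableI[where h = "\<lambda>x. if x \<in> A then g x else n + h x"])
    show "(if x \<in> A then g x else n + h x) < n + m" if "x \<in> A \<union> B" for x
      using that g(1)[of x] h(1)[of x] by auto
    show "(if x \<in> A then g x else n + h x) \<noteq> (if y \<in> A then g y else n + h y)"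
      if "x \<in> A \<union> B" "y \<in> A \<union> B" "E x y" for x y
      using that g(1)[of x] g(1)[of y] g(2)[of x y] h(2)[of x y] by auto
  qed
qed

text \<open>No edge joins two fibres, so all of them can use the same palette, however many there
  are.\<close>

lemma colorable_fibres:
  assumes "\<And>x y. x \<in> A \<Longrightarrow> y \<in> A \<Longrightarrow> E x y \<Longrightarrow> p x = p y"
    and "\<And>i. colorable E {x \<in> A. p x = i} m"
  shows "colorable E A m"
proof -
  have "\<forall>i. \<exists>h. (\<forall>x\<in>{x \<in> A. p x = i}. h x < m) \<and>
      (\<forall>x\<in>{x \<in> A. p x = i}. \<forall>y\<in>{x \<in> A. p x = i}. E x y \<longrightarrow> h x \<noteq> (h y :: nat))"
    using assms(2) unfolding colorable_def by blast
  from choice[OF this] obtain H where H: "\<And>i. (\<forall>x\<in>{x \<in> A. p x = i}. H i x < m) \<and>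
      (\<forall>x\<in>{x \<in> A. p x = i}. \<forall>y\<in>{x \<in> A. p x = i}. E x y \<longrightarrow> H i x \<noteq> (H i y :: nat))"
    by blast
  show ?thesis
  proof (rule colorableI[where h = "\<lambda>x. H (p x) x"])
    show "H (p x) x < m" if "x \<in> A" for x using H[of "p x"] that by blast
    show "H (p x) x \<noteq> H (p y) y" if "x \<in> A" "y \<in> A" "E x y" for x y
      using H[of "p x"] that assms(1)[OF that] by force
  qed
qed

text \<open>The palette consists of the pairs of a class and a color inside it, coded as
  \<open>h x * m + g x\<close>.\<close>

lemma colorable_classes:
  assumes "\<And>x. x \<in> A \<Longrightarrow> h x < n" "\<And>i. i < n \<Longrightarrow> colorable E {x \<in> A. h x = i} m"
  shows "colorable E A (n * m)"
proof -
  \<comment> \<open>Forgetting the edges between classes makes \<open>colorable_fibres\<close>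
    applicable, so that one function \<open>g\<close> colors all classes.\<close>
  have "colorable (\<lambda>x y. E x y \<and> h x = h y) A m"
  proof (rule colorable_fibres[where p = h])
    fix i
    show "colorable (\<lambda>x y. E x y \<and> h x = h y) {x \<in> A. h x = i} m"
    proof (cases "i < n")
      case True
      then show ?thesis by (rule colorable_mono[OF assms(2)]) auto
    next
      case False
      then have "{x \<in> A. h x = i} = {}" using assms(1) by auto
      then show ?thesis by (simp only: colorable_empty)
    qed
  qed auto
  then obtain g where g: "\<forall>x\<in>A. g x < m" "\<forall>x\<in>A. \<forall>y\<in>A. E x y \<and> h x = h y \<longrightarrow> g x \<noteq> (g y :: nat)"
    by (auto simp: colorable_def)
  have "h x * m + g x < n * m" if "x \<in> A" for x
  proof -
    have "h x * m + g x < Suc (h x) * m" using g(1) that by simp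
    also have "\<dots> \<le> n * m" using assms(1)[OF that] by (intro mult_le_mono1) auto
    finally show ?thesis .
  qed
  moreover have "h x * m + g x \<noteq> h y * m + g y" if "x \<in> A" "y \<in> A" "E x y" for x y
  proof
    assume eq: "h x * m + g x = h y * m + g y"
    have "(h x * m + g x) div m = h x" "(h y * m + g y) div m = h y" using g(1) that by auto
    then have "h x = h y" using eq by simp
    then show False using eq g(2) that by auto
  qed
  ultimately show ?thesis
    by (intro colorableI[where h = "\<lambda>x. h x * m + g x"])
qed

lemma colorable_product:
  assumes "colorable E1 A n"
    and "\<And>B. B \<subseteq> A \<Longrightarrow> (\<And>x y. x \<in> B \<Longrightarrow> y \<in> B \<Longrightarrow> \<not> E1 x y) \<Longrightarrow> colorable E B m"
  shows "colorable E A (n * m)"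
proof -
  obtain h where h: "\<forall>x\<in>A. h x < n" "\<forall>x\<in>A. \<forall>y\<in>A. E1 x y \<longrightarrow> h x \<noteq> h y"
    using assms(1) by (auto simp: colorable_def)
  show ?thesis
  proof (rule colorable_classes[where h = h])
    show "colorable E {x \<in> A. h x = i} m" for i
    proof (rule assms(2))
      show "\<not> E1 x y" if "x \<in> {x \<in> A. h x = i}" "y \<in> {x \<in> A. h x = i}" for x y
        using h(2) that by force
    qed auto
  qed (use h(1) in blast)
qed

lemma ex_class_not_colorable:
  assumes "\<not> colorable E A (n * m)" "\<And>x. x \<in> A \<Longrightarrow> h x < n"
  shows "\<exists>i<n. \<not> colorable E {x \<in> A. h x = i} m"
proof (rule ccontr)
  assume "\<not> ?thesis"
  then have "colorable E {x \<in> A. h x = i} m" if "i < n" for i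
    using that by blast
  then show False
    using colorable_classes[of A h n E m] assms by blast
qed

section \<open>Long edges and distance layers\<close>

text \<open>Scan \<open>A\<close> by increasing \<open>key\<close> and open a new block only when
  the current one together with the next element is no longer \<open>T + 1\<close>-colorable. One
  extra color would pay for that element, so a closed block is not even
  \<open>T\<close>-colorable.\<close>

lemma greedy_blocks:
  fixes key :: "'a \<Rightarrow> real"
  assumes "finite A" "inj_on key A" "\<And>x. \<not> E x x"
  shows "\<exists>h :: 'a \<Rightarrow> nat. (\<forall>n. colorable E {x \<in> A. h x = n} (T + 1)) \<and>
    (\<forall>a\<in>A. \<forall>b\<in>A. key a < key b \<longrightarrow> h a \<le> h b) \<and>
    (\<forall>a\<in>A. \<forall>n < h a. \<not> colorable E {x \<in> A. h x = n} T)"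
  using assms(1,2)
proof (induction "card A" arbitrary: A)
  case 0
  then have "A = {}" by simp
  then show ?case by simp
next
  case (Suc N)
  then have "A \<noteq> {}" by auto
  obtain b where b: "b \<in> A" "\<And>a. a \<in> A \<Longrightarrow> key a \<le> key b"
    using obtains_MAX[of A key] Suc.prems(1) \<open>A \<noteq> {}\<close>
    by (metis Max_ge finite_imageI imageI)
  define A' where "A' = A - {b}"
  have lt: "key a < key b" if "a \<in> A'" for a
  proof -
    have "a \<in> A" "a \<noteq> b" using that by (auto simp: A'_def)
    then show ?thesis using b Suc.prems(2) by (metis inj_on_eq_iff order_less_le)
  qed
  have A: "A = insert b A'" "b \<notin> A'" using b A'_def by auto
  have "N = card A'" using Suc A by auto
  moreover have "finite A'" "inj_on key A'" using Suc.prems by (auto simp: A'_def inj_on_diff)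
  ultimately obtain h where h: "\<And>n. colorable E {x \<in> A'. h x = n} (T + 1)"
    "\<And>a b. a\<in>A' \<Longrightarrow> b\<in>A' \<Longrightarrow> key a < key b \<Longrightarrow> h a \<le> h b"
    "\<And>a n. a\<in>A' \<Longrightarrow> n < (h a :: nat) \<Longrightarrow> \<not> colorable E {x \<in> A'. h x = n} T"
    using Suc.hyps(1)[of A'] by blast
  define M where "M = (if A' = {} then 0 else Max (h ` A'))"
  have M: "h a \<le> M" if "a \<in> A'" for a using that \<open>finite A'\<close> by (auto simp: M_def)
  have M_least: "\<not> colorable E {x \<in> A'. h x = n} T" if "n < M" for n
  proof -
    have "M \<in> h ` A'" using that \<open>finite A'\<close> by (auto simp: M_def split: if_splits)
    then show ?thesis using h(3) that by auto
  qed
  have b_insert: "{x \<in> A. (h(b := n)) x = n} = insert b {x \<in> A'. h x = n}"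
    "j \<noteq> n \<Longrightarrow> {x \<in> A. (h(b := n)) x = j} = {x \<in> A'. h x = j}" for n j
    using A by auto
  show ?case
  proof (cases "colorable E (insert b {x \<in> A'. h x = M}) (T + 1)")
    case True
    show ?thesis
    proof (intro exI[of _ "h(b := M)"] conjI allI ballI impI)
      show "colorable E {x \<in> A. (h(b := M)) x = n} (T + 1)" for n
        by (cases "n = M") (use b_insert True h(1) in auto)
      show "(h(b := M)) a \<le> (h(b := M)) b'" if "a \<in> A" "b' \<in> A" "key a < key b'" for a b'
        using that A h(2) M lt by (auto dest: order_less_asym)
      show "\<not> colorable E {x \<in> A. (h(b := M)) x = n} T" if "a \<in> A" "n < (h(b := M)) a" for a n
      proof -
        have "n < M" using that M A by (auto split: if_splits intro: order_less_le_trans)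
        then show ?thesis using M_least b_insert(2)[of n M] by auto
      qed
    qed
  next
    case False
    have new: "{x \<in> A'. h x = Suc M} = {}" using M by fastforce
    have full: "\<not> colorable E {x \<in> A'. h x = M} T"
    proof
      assume "colorable E {x \<in> A'. h x = M} T"
      then obtain g where g: "\<forall>x\<in>{x \<in> A'. h x = M}. g x < T"
        "\<forall>x\<in>{x \<in> A'. h x = M}. \<forall>y\<in>{x \<in> A'. h x = M}. E x y \<longrightarrow> g x \<noteq> (g y :: nat)"
        by (auto simp: colorable_def)
      have "colorable E (insert b {x \<in> A'. h x = M}) (T + 1)"
        by (rule colorableI[where h = "g(b := T)"]) (use g assms(3) A(2) in \<open>fastforce split: if_splits\<close>)+
      then show False using False by simp
    qed
    show ?thesis
    proof (intro exI[of _ "h(b := Suc M)"] conjI allI ballI impI)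
      show "colorable E {x \<in> A. (h(b := Suc M)) x = n} (T + 1)" for n
      proof (cases "n = Suc M")
        case True
        then have "{x \<in> A. (h(b := Suc M)) x = n} = {b}" using b_insert(1)[of "Suc M"] new by auto
        then show ?thesis using assms(3) by (auto simp: colorable_def)
      qed (use b_insert(2)[of n "Suc M"] h(1) in auto)
      show "(h(b := Suc M)) a \<le> (h(b := Suc M)) b'" if "a \<in> A" "b' \<in> A" "key a < key b'" for a b'
        using that A h(2) M lt by (auto dest: order_less_asym intro: le_SucI)
      show "\<not> colorable E {x \<in> A. (h(b := Suc M)) x = n} T" if "a \<in> A" "n < (h(b := Suc M)) a" for a n
      proof -
        have "n < Suc M" using that M A by (auto split: if_splits intro: order_less_le_trans le_SucI)
        then have "n < M \<or> n = M" "n \<noteq> Suc M" by auto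
        then show ?thesis using M_least full b_insert(2)[of n "Suc M"] by metis
      qed
    qed
  qed
qed

text \<open>Classify by the color inside the block and the parity of the block number. A class has
  no edge within a block and none between consecutive blocks, so each of its edges jumps over a
  complete block. The number of classes is the factor \<open>2 * (T + 1)\<close>.\<close>

lemma ex_long_edges:
  fixes key :: "'a \<Rightarrow> real"
  assumes "finite A" "inj_on key A" "\<And>x. \<not> E x x" "\<not> colorable E A (2 * (T + 1) * m)"
  shows "\<exists>C\<subseteq>A. \<not> colorable E C m \<and> (\<forall>a\<in>C. \<forall>b\<in>C. E a b \<and> key a < key b \<longrightarrow>
    \<not> colorable E {y \<in> A. key a < key y \<and> key y < key b} T)"
proof -
  obtain h :: "'a \<Rightarrow> nat" where h: "\<And>n. colorable E {x \<in> A. h x = n} (T + 1)"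
    "\<And>a b. a\<in>A \<Longrightarrow> b\<in>A \<Longrightarrow> key a < key b \<Longrightarrow> h a \<le> h b"
    "\<And>a n. a\<in>A \<Longrightarrow> n < h a \<Longrightarrow> \<not> colorable E {x \<in> A. h x = n} T"
    using greedy_blocks[of A key E T] assms(1-3) by blast
  have "colorable (\<lambda>x y. E x y \<and> h x = h y) A (T + 1)"
  proof (rule colorable_fibres[where p = h])
    show "colorable (\<lambda>x y. E x y \<and> h x = h y) {x \<in> A. h x = i} (T + 1)" for i
      by (rule colorable_mono[OF h(1)[of i]]) auto
  qed auto
  then obtain g :: "'a \<Rightarrow> nat" where g: "\<And>x. x \<in> A \<Longrightarrow> g x < T + 1"
    "\<And>x y. x \<in> A \<Longrightarrow> y \<in> A \<Longrightarrow> E x y \<and> h x = h y \<Longrightarrow> g x \<noteq> g y"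
    unfolding colorable_def by blast
  have "2 * g x + h x mod 2 < 2 * (T + 1)" if "x \<in> A" for x
  proof -
    have "h x mod 2 < 2" by simp
    moreover have "q < 2 \<Longrightarrow> 2 * a + q < 2 * (T + 1)" if "a < T + 1" for a q :: nat
      using that by presburger
    ultimately show ?thesis using g(1)[OF that] by blast
  qed
  from ex_class_not_colorable[where h = "\<lambda>x. 2 * g x + h x mod 2", OF assms(4) this]
  obtain i where i: "\<not> colorable E {x \<in> A. 2 * g x + h x mod 2 = i} m"
    by blast
  have "\<not> colorable E {y \<in> A. key a < key y \<and> key y < key b} T"
    if ab: "a \<in> A" "b \<in> A" "2 * g a + h a mod 2 = i" "2 * g b + h b mod 2 = i" "E a b" "key a < key b" for a b
  proof -
    have "h a mod 2 = h b mod 2" "g a = g b" using ab(3,4) by presburger+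
    moreover have "h a \<noteq> h b" using g(2) ab \<open>g a = g b\<close> by blast
    moreover have "h a \<le> h b" using h(2) ab by blast
    ultimately have "Suc (h a) < h b" by presburger
    then have "\<not> colorable E {x \<in> A. h x = Suc (h a)} T" using h(3) ab(2) by blast
    moreover have "{x \<in> A. h x = Suc (h a)} \<subseteq> {y \<in> A. key a < key y \<and> key y < key b}"
    proof clarify
      fix x assume x: "x \<in> A" "h x = Suc (h a)"
      then have "x \<noteq> a" "x \<noteq> b" using \<open>Suc (h a) < h b\<close> by auto
      then have "key x \<noteq> key a" "key x \<noteq> key b"
        using inj_onD[OF assms(2)] x(1) ab(1,2) by blast+
      moreover have "\<not> key x < key a" using x h(2)[of x a] ab(1) by auto
      moreover have "\<not> key b < key x" using x h(2)[of b x] ab(2) \<open>Suc (h a) < h b\<close> by auto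
      ultimately show "key a < key x \<and> key x < key b" by linarith
    qed
    ultimately show ?thesis using colorable_subset by blast
  qed
  with i show ?thesis
    by (intro exI[of _ "{x \<in> A. 2 * g x + h x mod 2 = i}"]) blast
qed

text \<open>These are the breadth-first layers of a component around its member
  \<open>\<rho>\<close> of least \<open>key\<close>, reduced to the properties that the trapping
  argument uses.\<close>

definition distance_layers ::
    "('a \<Rightarrow> 'a \<Rightarrow> bool) \<Rightarrow> 'a set \<Rightarrow> ('a \<Rightarrow> real) \<Rightarrow> 'a \<Rightarrow> (nat \<Rightarrow> 'a set) \<Rightarrow> bool" where
  "distance_layers E X key \<rho> S \<longleftrightarrow> S 0 = {\<rho>} \<and> (\<forall>i. S i \<subseteq> X) \<and> (\<forall>i. \<forall>x\<in>S i. key \<rho> \<le> key x) \<and>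
    (\<forall>i. \<forall>x\<in>S (Suc i). \<exists>z\<in>S i. E x z) \<and> (\<forall>i j. \<forall>x\<in>S i. x \<in> S j \<longrightarrow> i = j) \<and>
    (\<forall>i j. \<forall>x\<in>S i. \<forall>y\<in>S j. E x y \<longrightarrow> j \<le> Suc i)"

lemma distance_layersD:
  assumes "distance_layers E X key \<rho> S"
  shows "S 0 = {\<rho>}" "\<And>i. S i \<subseteq> X" "\<And>i x. x \<in> S i \<Longrightarrow> key \<rho> \<le> key x"
    "\<And>i x. x \<in> S (Suc i) \<Longrightarrow> \<exists>z\<in>S i. E x z" "\<And>i j x. x \<in> S i \<Longrightarrow> x \<in> S j \<Longrightarrow> i = j"
    "\<And>i j x y. x \<in> S i \<Longrightarrow> y \<in> S j \<Longrightarrow> E x y \<Longrightarrow> j \<le> Suc i"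
proof -
  note * = assms[unfolded distance_layers_def]
  note ** = *[THEN conjunct2] *[THEN conjunct2, THEN conjunct2] *[THEN conjunct2, THEN conjunct2, THEN conjunct2]
    *[THEN conjunct2, THEN conjunct2, THEN conjunct2, THEN conjunct2]
  show "S 0 = {\<rho>}" by (rule *[THEN conjunct1])
  show "S i \<subseteq> X" for i by (rule **(1)[THEN conjunct1, rule_format])
  show "key \<rho> \<le> key x" if "x \<in> S i" for i x by (rule **(2)[THEN conjunct1, rule_format, OF that])
  show "\<exists>z\<in>S i. E x z" if "x \<in> S (Suc i)" for i x
    by (rule **(3)[THEN conjunct1, rule_format, OF that])
  show "i = j" if "x \<in> S i" "x \<in> S j" for i j x
    by (rule **(4)[THEN conjunct1, rule_format, OF that])
  show "j \<le> Suc i" if "x \<in> S i" "y \<in> S j" "E x y" for i j x y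
    by (rule **(4)[THEN conjunct2, rule_format, OF that])
qed

text \<open>An edge stays in its component and changes the distance by at most one. Among the layers
  of one parity, edges therefore stay inside a single layer; if all layers were
  \<open>n\<close>-colorable, two palettes would suffice.\<close>

lemma ex_distance_layer:
  fixes key :: "'a \<Rightarrow> real"
  assumes "finite X" "\<And>x y. E x y \<Longrightarrow> E y x" "\<not> colorable E X (2 * n)"
  shows "\<exists>\<rho> S d. distance_layers E X key \<rho> S \<and> \<not> colorable E (S d) n"
proof -
  define R where "R = {(x, y). x \<in> X \<and> y \<in> X \<and> E x y}"
  have sym: "sym (R\<^sup>*)"
    by (rule sym_rtrancl) (auto simp: R_def sym_def intro: assms(2))
  \<comment> \<open>The choice depends on \<open>x\<close> only through its component, so all
    members of a component get the same root even if \<open>key\<close> has ties.\<close>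
  define root where "root x = (SOME z. z \<in> R\<^sup>* `` {x} \<and> (\<forall>y\<in>R\<^sup>* `` {x}. key z \<le> key y))" for x
  have inX: "y \<in> X" if "(x, y) \<in> R\<^sup>*" "x \<in> X" for x y
    using that by (induction rule: rtrancl_induct) (auto simp: R_def)
  have root: "(x, root x) \<in> R\<^sup>*" "\<And>y. (x, y) \<in> R\<^sup>* \<Longrightarrow> key (root x) \<le> key y" if "x \<in> X" for x
  proof -
    have "finite (R\<^sup>* `` {x})" using inX[OF _ that] by (intro finite_subset[OF _ assms(1)]) auto
    moreover have "x \<in> R\<^sup>* `` {x}" by auto
    ultimately have "\<exists>z. z \<in> R\<^sup>* `` {x} \<and> (\<forall>y\<in>R\<^sup>* `` {x}. key z \<le> key y)"
      by (metis arg_min_if_finite(1,2) empty_iff linorder_not_less)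
    from someI_ex[OF this] show "(x, root x) \<in> R\<^sup>*" "\<And>y. (x, y) \<in> R\<^sup>* \<Longrightarrow> key (root x) \<le> key y"
      unfolding root_def[symmetric] by auto
  qed
  have root_eq: "root x = root y" if "(x, y) \<in> R\<^sup>*" for x y
  proof -
    have "R\<^sup>* `` {x} = R\<^sup>* `` {y}" using that sym by (auto dest: symD intro: rtrancl_trans)
    then show ?thesis unfolding root_def by simp
  qed
  define dist where "dist x = (LEAST n. (root x, x) \<in> R ^^ n)" for x
  have dist: "(root x, x) \<in> R ^^ dist x" if "x \<in> X" for x
  proof -
    have "(root x, x) \<in> R\<^sup>*" using root(1)[OF that] sym by (auto dest: symD)
    then obtain n where "(root x, x) \<in> R ^^ n" using rtrancl_power by blast
    then show ?thesis unfolding dist_def by (rule LeastI)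
  qed
  have dist_le: "dist x \<le> n" if "(root x, x) \<in> R ^^ n" for x n
    unfolding dist_def using that by (rule Least_le)
  have step: "dist y \<le> Suc (dist x)" "root x = root y" if "(x, y) \<in> R" for x y
  proof -
    show eq: "root x = root y" using that by (intro root_eq) auto
    have "(root x, x) \<in> R ^^ dist x" using that dist by (auto simp: R_def)
    then have "(root y, y) \<in> R ^^ Suc (dist x)" using that eq by auto
    then show "dist y \<le> Suc (dist x)" by (rule dist_le)
  qed
  define S where "S \<rho> i = {x \<in> X. root x = \<rho> \<and> dist x = i}" for \<rho> i
  have "\<exists>\<rho> d. \<not> colorable E (S \<rho> d) n"
  proof (rule ccontr)
    assume *: "\<not> ?thesis"
    have "colorable E X (2 * n)"
    proof (rule colorable_classes[where h = "\<lambda>x. dist x mod 2"])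
      fix p :: nat
      show "colorable E {x \<in> X. dist x mod 2 = p} n"
      proof (rule colorable_fibres[where p = "\<lambda>x. (root x, dist x)"])
        fix x y assume xy: "x \<in> {x \<in> X. dist x mod 2 = p}" "y \<in> {x \<in> X. dist x mod 2 = p}" "E x y"
        then have R: "(x, y) \<in> R" "(y, x) \<in> R" using assms(2)[OF xy(3)] by (auto simp: R_def)
        have "root x = root y" by (rule step(2)[OF R(1)])
        moreover have "dist x \<le> Suc (dist y)" "dist y \<le> Suc (dist x)"
          by (rule step(1)[OF R(2)], rule step(1)[OF R(1)])
        moreover have "dist x mod 2 = dist y mod 2" using xy(1,2) by simp
        ultimately have "dist x = dist y" by presburger
        with \<open>root x = root y\<close> show "(root x, dist x) = (root y, dist y)" by simp
      next
        fix i
        show "colorable E {x \<in> {x \<in> X. dist x mod 2 = p}. (root x, dist x) = i} n"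
        proof (rule colorable_subset)
          show "colorable E (S (fst i) (snd i)) n" using * by blast
        qed (auto simp: S_def)
      qed
    qed auto
    then show False using assms(3) by blast
  qed
  then obtain \<rho> d where nc: "\<not> colorable E (S \<rho> d) n" by blast
  have "S \<rho> d \<noteq> {}"
    using nc by auto
  then obtain x0 where x0: "x0 \<in> X" "root x0 = \<rho>" by (auto simp: S_def)
  have \<rho>: "\<rho> \<in> X" "root \<rho> = \<rho>" using root(1)[of x0] inX root_eq x0 by auto
  have "distance_layers E X key \<rho> (S \<rho>)"
    unfolding distance_layers_def
  proof (intro conjI allI ballI impI)
    show "S \<rho> 0 = {\<rho>}"
    proof
      show "S \<rho> 0 \<subseteq> {\<rho>}" using dist by (force simp: S_def)
      have "dist \<rho> = 0" using dist_le[of \<rho> 0] \<rho> by simp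
      then show "{\<rho>} \<subseteq> S \<rho> 0" using \<rho> by (auto simp: S_def)
    qed
    show "S \<rho> i \<subseteq> X" for i by (auto simp: S_def)
    show "key \<rho> \<le> key x" if "x \<in> S \<rho> i" for i x
      using root(2)[of x x] that by (auto simp: S_def)
    show "\<exists>z\<in>S \<rho> i. E x z" if x: "x \<in> S \<rho> (Suc i)" for i x
    proof -
      have "(\<rho>, x) \<in> R ^^ Suc i" using dist[of x] x by (auto simp: S_def)
      then obtain z where z: "(\<rho>, z) \<in> R ^^ i" "(z, x) \<in> R" by auto
      then have "z \<in> X" "E x z" "root z = \<rho>" using step(2)[OF z(2)] x
        by (auto simp: R_def S_def intro: assms(2))
      moreover have "dist z = i" using step(1)[OF z(2)] dist_le[of z i] z(1) x \<open>root z = \<rho>\<close>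
        by (auto simp: S_def)
      ultimately show ?thesis by (auto simp: S_def)
    qed
    show "i = j" if "x \<in> S \<rho> i" "x \<in> S \<rho> j" for i j x using that by (auto simp: S_def)
    show "j \<le> Suc i" if "x \<in> S \<rho> i" "y \<in> S \<rho> j" "E x y" for i j x y
      using that step(1)[of x y] by (auto simp: S_def R_def)
  qed
  with nc show ?thesis by blast
qed

section \<open>Flags\<close>

definition adj :: "('a \<Rightarrow> real \<Rightarrow> real) \<Rightarrow> ('a \<Rightarrow> real) \<Rightarrow> 'a \<Rightarrow> 'a \<Rightarrow> bool" where
  "adj f r i j \<longleftrightarrow> i \<noteq> j \<and> (\<exists>t. 0 \<le> t \<and> t \<le> r i \<and> t \<le> r j \<and> f i t = f j t)"

lemma adj_sym: "adj f r i j \<longleftrightarrow> adj f r j i"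
  unfolding adj_def by metis

lemma adj_irrefl: "\<not> adj f r i i"
  by (simp add: adj_def)

text \<open>
  The flag \<open>i\<close> is the graph of \<open>f i\<close> over \<open>[0, r i]\<close>. Instead of continuity, only its effect on the
  vertical order of two flags is assumed; this makes truncating flags harmless.
\<close>

locale flags =
  fixes V :: "'a set" and f :: "'a \<Rightarrow> real \<Rightarrow> real" and r :: "'a \<Rightarrow> real"
  assumes finite_V: "finite V"
    and r_nonneg: "i \<in> V \<Longrightarrow> 0 \<le> r i"
    and inj_ground: "\<lbrakk>i \<in> V; j \<in> V; f i 0 = f j 0\<rbrakk> \<Longrightarrow> i = j"
    and order_kept: "\<lbrakk>i \<in> V; j \<in> V; f i 0 < f j 0; 0 \<le> x; x \<le> r i; x \<le> r j;
      \<And>t. \<lbrakk>0 \<le> t; t \<le> x\<rbrakk> \<Longrightarrow> f i t \<noteq> f j t\<rbrakk> \<Longrightarrow> f i x < f j x"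
    and order_swapped: "\<lbrakk>i \<in> V; j \<in> V; f i 0 < f j 0; 0 \<le> t; t < x; x \<le> r i; x \<le> r j;
      f i t = f j t\<rbrakk> \<Longrightarrow> f j x < f i x"
begin

abbreviation E where "E \<equiv> adj f r"
abbreviation g where "g i \<equiv> f i 0"

section \<open>Vertical order and adjacency of two flags\<close>

lemma ex_meeting:
  assumes "i \<in> V" "j \<in> V" "g i < g j" "0 \<le> x" "x \<le> r i" "x \<le> r j" "f j x \<le> f i x"
  shows "\<exists>t. 0 \<le> t \<and> t \<le> x \<and> f i t = f j t"
proof (rule ccontr)
  assume "\<not> ?thesis"
  then have "f i t \<noteq> f j t" if "0 \<le> t" "t \<le> x" for t using that by blast
  then have "f i x < f j x" by (rule order_kept[OF assms(1-6)])
  then show False using assms(7) by simp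
qed

lemma adjI:
  assumes "i \<in> V" "j \<in> V" "g i < g j" "0 \<le> x" "x \<le> r i" "x \<le> r j" "f j x \<le> f i x"
  shows "E i j"
proof -
  obtain t where "0 \<le> t" "t \<le> x" "f i t = f j t" using ex_meeting assms by blast
  moreover have "i \<noteq> j" "t \<le> r i" "t \<le> r j" using assms(3,5,6) \<open>t \<le> x\<close> by auto
  ultimately show ?thesis unfolding adj_def by blast
qed

lemma nonadj_less:
  assumes "\<not> E i j" "i \<in> V" "j \<in> V" "g i < g j" "0 \<le> x" "x \<le> r i" "x \<le> r j"
  shows "f i x < f j x"
proof (rule ccontr)
  assume "\<not> f i x < f j x"
  then have "f j x \<le> f i x" by simp
  then show False using adjI[OF assms(2-7)] assms(1) by blast
qed

lemma swapped_mono: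
  assumes "i \<in> V" "j \<in> V" "g i < g j" "0 \<le> x" "f j x \<le> f i x" "x < y" "y \<le> r i" "y \<le> r j"
  shows "f j y < f i y"
proof -
  obtain t where "0 \<le> t" "t \<le> x" "f i t = f j t" using ex_meeting[of i j x] assms by auto
  then show ?thesis using order_swapped[of i j t y] assms by auto
qed

text \<open>The flags agree where they meet and are swapped afterwards, so the end of the common
  domain witnesses every crossing. Together with \<open>adjI\<close> this turns crossing into a
  single comparison.\<close>

lemma adj_swapped_at_end:
  assumes "E i j" "i \<in> V" "j \<in> V" "g i < g j"
  shows "f j (min (r i) (r j)) \<le> f i (min (r i) (r j))"
proof -
  obtain t where t: "0 \<le> t" "t \<le> r i" "t \<le> r j" "f i t = f j t" using assms(1) by (auto simp: adj_def)
  show ?thesis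
  proof (cases "t = min (r i) (r j)")
    case False
    then have "f j (min (r i) (r j)) < f i (min (r i) (r j))"
      using t assms by (intro order_swapped[of i j t]) auto
    then show ?thesis by simp
  qed (use t in auto)
qed

lemma inj_on_ground: "A \<subseteq> V \<Longrightarrow> inj_on g A"
  using inj_ground by (auto intro!: inj_onI)

lemma mirror_flags: "flags V (\<lambda>i x. - f i x) r"
proof
  show "- f i x < - f j x" if "i \<in> V" "j \<in> V" "- g i < - g j" "0 \<le> x" "x \<le> r i" "x \<le> r j"
    "\<And>t. \<lbrakk>0 \<le> t; t \<le> x\<rbrakk> \<Longrightarrow> - f i t \<noteq> - f j t" for i j x
    using order_kept[of j i x] that by force
qed (use finite_V r_nonneg inj_ground order_swapped in auto)

text \<open>If \<open>a\<close> and \<open>b\<close> cross, \<open>y\<close> is confined to the region that they enclose with the ground line.\<close>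

definition trapped :: "'a \<Rightarrow> 'a \<Rightarrow> 'a \<Rightarrow> bool" where
  "trapped a b y \<longleftrightarrow> y \<in> V \<and> g a < g y \<and> g y < g b \<and> \<not> E y a \<and> \<not> E y b"

text \<open>At the end of the shorter of \<open>a\<close> and \<open>b\<close> their order is
  reversed. A flag that had stayed above \<open>a\<close> and below \<open>b\<close> until then
  would have no room, so \<open>y\<close> ends earlier.\<close>

lemma trappedD:
  assumes "trapped a b y" "a \<in> V" "b \<in> V" "E a b"
  shows "y \<in> V" "g a < g y" "g y < g b" "\<not> E y a" "\<not> E y b" "r y < r a" "r y < r b"
    "\<And>x. \<lbrakk>0 \<le> x; x \<le> r y\<rbrakk> \<Longrightarrow> f a x < f y x" "\<And>x. \<lbrakk>0 \<le> x; x \<le> r y\<rbrakk> \<Longrightarrow> f y x < f b x"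
proof -
  show y: "y \<in> V" "g a < g y" "g y < g b" "\<not> E y a" "\<not> E y b" using assms by (auto simp: trapped_def)
  let ?m = "min (r a) (r b)"
  have m: "f b ?m \<le> f a ?m" using adj_swapped_at_end[of a b] assms y by auto
  have "r y < ?m"
  proof (rule ccontr)
    assume "\<not> r y < ?m"
    then have "f a ?m < f y ?m" "f y ?m < f b ?m"
      using nonadj_less[of a y ?m] nonadj_less[of y b ?m] y assms r_nonneg adj_sym[of f r a y] by auto
    then show False using m by simp
  qed
  then show *: "r y < r a" "r y < r b" by auto
  show "f a x < f y x" if "0 \<le> x" "x \<le> r y" for x
    using nonadj_less[of a y x] y assms that * adj_sym[of f r a y] by auto
  show "f y x < f b x" if "0 \<le> x" "x \<le> r y" for x
    using nonadj_less[of y b x] y assms that * by auto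
qed

text \<open>To meet \<open>y\<close>, \<open>w\<close> has to rise to its height, and
  \<open>y\<close> lies above \<open>a\<close> all its life.\<close>

lemma enters_from_below:
  assumes "a \<in> V" "b \<in> V" "E a b" "trapped a b y" "w \<in> V" "g w < g a" "E y w"
  shows "E a w"
proof -
  note y = trappedD[OF assms(4,1-3)]
  let ?s = "min (r w) (r y)"
  have s: "0 \<le> ?s" "?s \<le> r w" "?s \<le> r y" "?s \<le> r a" using r_nonneg assms(5) y by auto
  have "f y ?s \<le> f w ?s" using adj_swapped_at_end[of w y] assms y adj_sym[of f r w y] by auto
  moreover have "f a ?s < f y ?s" using y(8) s by auto
  ultimately have "E w a" using adjI[of w a ?s] assms s by auto
  then show ?thesis using adj_sym[of f r a w] by simp
qed

lemma enters_from_above: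
  assumes "a \<in> V" "b \<in> V" "E a b" "trapped a b y" "w \<in> V" "g b < g w" "E y w"
  shows "E b w"
proof -
  interpret mir: flags V "\<lambda>i x. - f i x" r by (rule mirror_flags)
  have "adj (\<lambda>i x. - f i x) r = E" by (auto simp: adj_def fun_eq_iff)
  then show ?thesis
    using mir.enters_from_below[of b a y w] assms adj_sym[of f r a b]
    by (auto simp: mir.trapped_def trapped_def)
qed

text \<open>A neighbor of a trapped flag that started outside would have to cross \<open>a\<close>
  or \<open>b\<close> on its way in. This lets trappedness propagate backwards along breadth-first
  paths.\<close>

lemma trapped_closed:
  assumes "a \<in> V" "b \<in> V" "E a b" "trapped a b y" "w \<in> V" "\<not> E w a" "\<not> E w b" "w \<noteq> a" "w \<noteq> b" "E y w"
  shows "trapped a b w"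
proof -
  have "g w \<noteq> g a" "g w \<noteq> g b" using inj_ground assms by blast+
  moreover have "\<not> g w < g a" "\<not> g b < g w"
    using enters_from_below[of a b y w] enters_from_above[of a b y w] assms
      adj_sym[of f r a w] adj_sym[of f r b w] by auto
  ultimately show ?thesis using assms unfolding trapped_def by auto
qed

text \<open>Otherwise \<open>w'\<close> stays between \<open>x\<close> and \<open>w\<close> while it
  lives; since \<open>x\<close> has passed \<open>w\<close> at the end of their common domain,
  \<open>w'\<close> ends first. It then ends above \<open>x\<close>, so it has not left through
  \<open>a\<close>; leaving through \<open>b\<close> would put \<open>w\<close> above
  \<open>b\<close> for good, out of reach of \<open>x\<close>.\<close>

lemma wall_contiguous:
  assumes ab: "a \<in> V" "b \<in> V" "E a b" and x: "trapped a b x"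
    and w: "w \<in> V" "w' \<in> V" "g x < g w'" "g w' < g w" "g w < g b" "\<not> E w w'"
    and "E w' a \<or> E w' b" "E x w"
  shows "E x w'"
proof (rule ccontr)
  assume n: "\<not> E x w'"
  note x = trappedD[OF x ab]
  let ?s = "min (r x) (r w)"
  have s: "0 \<le> ?s" "?s \<le> r x" "?s \<le> r w" using r_nonneg w x by auto
  have h: "f w ?s \<le> f x ?s" using adj_swapped_at_end[of x w] assms x by auto
  have ww: "f w' t < f w t" if "0 \<le> t" "t \<le> r w'" "t \<le> r w" for t
    using nonadj_less[of w' w t] w that adj_sym[of f r w w'] by auto
  have xw: "f x t < f w' t" if "0 \<le> t" "t \<le> r x" "t \<le> r w'" for t
    using nonadj_less[of x w' t] w x that n by auto
  show False
  proof (cases "?s \<le> r w'")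
    case True
    then show False using ww[of ?s] xw[of ?s] s h by linarith
  next
    case False
    let ?e = "r w'"
    have e: "0 \<le> ?e" "?e < ?s" "?e \<le> r x" "?e \<le> r w" "?e \<le> r a" "?e \<le> r b"
      using False s x(6,7) r_nonneg[OF w(2)] by linarith+
    have *: "f x ?e < f w' ?e" "f w' ?e < f w ?e" "f a ?e < f x ?e" "f x ?e < f b ?e"
      using xw[of ?e] ww[of ?e] x(8,9)[of ?e] e by auto
    show False
      using assms(11)
    proof
      assume "E w' a"
      then have "f w' ?e \<le> f a ?e"
        using adj_swapped_at_end[of a w'] e w x ab adj_sym[of f r a w'] by (auto simp: min_absorb2)
      then show False using * by linarith
    next
      assume "E w' b"
      then have "f b ?e \<le> f w' ?e"
        using adj_swapped_at_end[of w' b] e w x ab by (auto simp: min_absorb1)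
      then have "f b ?s < f w ?s"
        using swapped_mono[of w b ?e ?s] e s w ab * x(7) by auto
      then show False using h x(9)[of ?s] s by linarith
    qed
  qed
qed

text \<open>If \<open>w\<close> avoided both, it would keep \<open>u\<close> and \<open>v\<close>
  apart until its end. Ending between them means ending inside the trap, so it would have met
  neither \<open>a\<close> nor \<open>b\<close>.\<close>

lemma wall_separates:
  assumes ab: "a \<in> V" "b \<in> V" "E a b" and u: "trapped a b u" and v: "trapped a b v"
    and w: "w \<in> V" "g u < g w" "g w < g v" and "E w a \<or> E w b" "E u v"
  shows "E u w \<or> E w v"
proof (rule ccontr)
  assume n: "\<not> ?thesis"
  note u = trappedD[OF u ab] and v = trappedD[OF v ab]
  let ?s = "min (r u) (r v)"
  have s: "0 \<le> ?s" "?s \<le> r u" "?s \<le> r v" using r_nonneg u v by auto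
  have h: "f v ?s \<le> f u ?s" using adj_swapped_at_end[of u v] assms u v by auto
  have uw: "f u t < f w t" if "0 \<le> t" "t \<le> r u" "t \<le> r w" for t
    using nonadj_less[of u w t] w u that n by auto
  have wv: "f w t < f v t" if "0 \<le> t" "t \<le> r w" "t \<le> r v" for t
    using nonadj_less[of w v t] w v that n by auto
  show False
  proof (cases "?s \<le> r w")
    case True
    then show False using uw[of ?s] wv[of ?s] s h by linarith
  next
    case False
    let ?e = "r w"
    have e: "0 \<le> ?e" "?e < ?s" "?e \<le> r u" "?e \<le> r v" "?e \<le> r a" "?e \<le> r b"
      using False s u(6,7) r_nonneg[OF w(1)] by linarith+
    have *: "f u ?e < f w ?e" "f w ?e < f v ?e" "f a ?e < f u ?e" "f v ?e < f b ?e"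
      using uw[of ?e] wv[of ?e] u(8)[of ?e] v(9)[of ?e] e by auto
    show False
      using assms(9)
    proof
      assume "E w a"
      then have "f w ?e \<le> f a ?e"
        using adj_swapped_at_end[of a w] e w u ab adj_sym[of f r a w] by (auto simp: min_absorb2)
      then show False using * by linarith
    next
      assume "E w b"
      then have "f b ?e \<le> f w ?e"
        using adj_swapped_at_end[of w b] e w v ab by (auto simp: min_absorb1)
      then show False using * by linarith
    qed
  qed
qed

text \<open>\<open>v\<close> would get below \<open>w\<close> and above \<open>w'\<close>, although
  \<open>w\<close> stays below \<open>w'\<close>. A wall that ends too early for this clash can only
  have left through the side that forces the other wall out of the trap as well, where
  \<open>v\<close> cannot meet it.\<close>

lemma not_adj_walls_on_both_sides:
  assumes ab: "a \<in> V" "b \<in> V" "E a b" and v: "trapped a b v"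
    and w: "w \<in> V" "w' \<in> V" "g a < g w" "g w < g v" "g v < g w'" "g w' < g b" "\<not> E w w'"
    and exits: "E w a \<or> E w b" "E w' a \<or> E w' b" and adj: "E w v" "E v w'"
  shows False
proof -
  note v = trappedD[OF v ab]
  let ?s = "min (r w) (r v)" and ?s' = "min (r v) (r w')"
  have s: "0 \<le> ?s" "?s \<le> r v" "?s \<le> r w" "0 \<le> ?s'" "?s' \<le> r v" "?s' \<le> r w'"
    using r_nonneg v w by auto
  have h: "f v ?s \<le> f w ?s" "f w' ?s' \<le> f v ?s'"
    using adj_swapped_at_end[of w v] adj_swapped_at_end[of v w'] assms v by auto
  have ww: "f w t < f w' t" if "0 \<le> t" "t \<le> r w" "t \<le> r w'" for t
    using nonadj_less[of w w' t] w that by auto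
  \<comment> \<open>In cases 2 and 3 both walls live at the later of \<open>?s\<close> and
    \<open>?s'\<close>, and the orders clash there. In case 1 \<open>w'\<close> has ended before, in
    case 4 \<open>w\<close> has.\<close>
  consider "r w' < ?s" | "?s \<le> r w'" "?s' \<le> ?s" | "?s \<le> r w'" "?s < ?s'" "?s' \<le> r w" | "?s \<le> r w'" "?s < ?s'" "r w < ?s'"
    by linarith
  then show False
  proof cases
    case 1
    let ?e = "r w'"
    have e: "?s' = ?e" "0 \<le> ?e" "?e \<le> r v" "?e \<le> r w" "?e \<le> r a" "?e \<le> r b" "?s \<le> r a"
      using 1 s v(6,7) r_nonneg[OF w(2)] by linarith+
    have *: "f w' ?e \<le> f v ?e" "f w ?e < f w' ?e" "f a ?e < f v ?e" "f v ?e < f b ?e"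
      using h(2) ww[of ?e] v(8,9)[of ?e] e by auto
    show False
      using exits(2)
    proof
      assume "E w' a"
      then have "f w' ?e \<le> f a ?e"
        using adj_swapped_at_end[of a w'] e w v ab adj_sym[of f r a w'] by (auto simp: min_absorb2)
      then have "f w ?s < f a ?s"
        using swapped_mono[of a w ?e ?s] e s w ab * 1 by auto
      then show False using h(1) v(8)[of ?s] s by linarith
    next
      assume "E w' b"
      then have "f b ?e \<le> f w' ?e"
        using adj_swapped_at_end[of w' b] e w v ab by (auto simp: min_absorb1)
      then show False using * by linarith
    qed
  next
    case 2
    have "f w' ?s \<le> f v ?s"
    proof (cases "?s' = ?s")
      case False
      then have "f w' ?s < f v ?s" using swapped_mono[of v w' ?s' ?s] 2 s w v h by auto
      then show ?thesis by simp
    qed (use h in auto)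
    then show False using h(1) ww[of ?s] s 2 by linarith
  next
    case 3
    then have "f v ?s' < f w ?s'" using swapped_mono[of w v ?s ?s'] s w v h by auto
    then show False using h(2) ww[of ?s'] s 3 by linarith
  next
    case 4
    let ?e = "r w"
    have e: "?s = ?e" "0 \<le> ?e" "?e \<le> r v" "?e \<le> r w'" "?e \<le> r a" "?e \<le> r b" "?s' \<le> r b"
      using 4 s v(6,7) r_nonneg[OF w(1)] by linarith+
    have *: "f v ?e \<le> f w ?e" "f w ?e < f w' ?e" "f a ?e < f v ?e" "f v ?e < f b ?e"
      using h(1) ww[of ?e] v(8,9)[of ?e] e by auto
    show False
      using exits(1)
    proof
      assume "E w a"
      then have "f w ?e \<le> f a ?e"
        using adj_swapped_at_end[of a w] e w v ab adj_sym[of f r a w] by (auto simp: min_absorb2)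
      then show False using * by linarith
    next
      assume "E w b"
      then have "f b ?e \<le> f w ?e"
        using adj_swapped_at_end[of w b] e w v ab by (auto simp: min_absorb1)
      then have "f b ?s' < f w' ?s'"
        using swapped_mono[of w' b ?e ?s'] e s w ab * 4 by auto
      then show False using h(2) v(9)[of ?s'] s by linarith
    qed
  qed
qed

end

section \<open>Walls and needles\<close>

text \<open>
  Two ways in which a family \<open>W\<close> dominates a family \<open>X\<close> of flags, both up to reflection: the
  members of \<open>W\<close> start among those of \<open>X\<close> and cut the region containing \<open>X\<close> into cells that
  are traversed upwards, or they start below all of \<open>X\<close> and intrude from there.
\<close>

definition wall :: "('a \<Rightarrow> real \<Rightarrow> real) \<Rightarrow> ('a \<Rightarrow> real) \<Rightarrow> 'a set \<Rightarrow> 'a set \<Rightarrow> bool" where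
  "wall f r X W \<longleftrightarrow>
    (\<forall>x\<in>X. \<exists>w\<in>W. f x 0 < f w 0 \<and> (\<forall>w'\<in>W. f x 0 < f w' 0 \<and> f w' 0 \<le> f w 0 \<longrightarrow> adj f r x w')) \<and>
    (\<forall>u\<in>X. \<forall>v\<in>X. \<forall>w\<in>W. f u 0 < f w 0 \<and> f w 0 < f v 0 \<and> adj f r u v \<longrightarrow> adj f r u w)"

definition needle :: "('a \<Rightarrow> real \<Rightarrow> real) \<Rightarrow> ('a \<Rightarrow> real) \<Rightarrow> 'a set \<Rightarrow> 'a set \<Rightarrow> bool" where
  "needle f r X W \<longleftrightarrow> (\<forall>w\<in>W. \<forall>w'\<in>W. \<not> adj f r w w') \<and> (\<forall>w\<in>W. \<forall>x\<in>X. f w 0 < f x 0) \<and>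
    (\<forall>x\<in>X. \<exists>w\<in>W. adj f r x w)"

abbreviation mirror :: "('a \<Rightarrow> real \<Rightarrow> real) \<Rightarrow> 'a \<Rightarrow> real \<Rightarrow> real" where
  "mirror f \<equiv> (\<lambda>i x. - f i x)"

lemma adj_mirror: "adj (mirror f) r = adj f r"
  by (simp add: adj_def fun_eq_iff)

text \<open>The first half is \<open>wall_contiguous\<close>. For the second, \<open>v\<close> meets
  a wall above itself and hence none below, so the wall \<open>w\<close> that separates
  \<open>u\<close> from \<open>v\<close> must meet \<open>u\<close>.\<close>

lemma (in flags) wall_of_trapped:
  assumes ab: "a \<in> V" "b \<in> V" "E a b" and X: "\<And>x. x \<in> X \<Longrightarrow> trapped a b x"
    and W: "W \<subseteq> V" "\<And>w. w \<in> W \<Longrightarrow> g a < g w \<and> g w < g b \<and> (E w a \<or> E w b)"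
      "\<And>w w'. \<lbrakk>w \<in> W; w' \<in> W\<rbrakk> \<Longrightarrow> \<not> E w w'"
    and dom: "\<And>x. x \<in> X \<Longrightarrow> \<exists>w\<in>W. g x < g w \<and> E x w"
  shows "wall f r X W"
  unfolding wall_def
proof (intro conjI ballI impI)
  fix x assume x: "x \<in> X"
  then obtain w where w: "w \<in> W" "g x < g w" "E x w" using dom by blast
  have "E x w'" if w': "w' \<in> W" "g x < g w'" "g w' \<le> g w" for w'
  proof (cases "w' = w")
    case False
    then have "g w' < g w" using inj_ground[of w' w] w w' W(1) by fastforce
    then show ?thesis
      using wall_contiguous[OF ab X[OF x], of w w'] w w' W(1) W(2)[of w] W(2)[of w'] W(3)[of w w'] by blast
  qed (use w in simp)
  with w show "\<exists>w\<in>W. g x < g w \<and> (\<forall>w'\<in>W. g x < g w' \<and> g w' \<le> g w \<longrightarrow> E x w')" by blast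
next
  fix u v w assume *: "u \<in> X" "v \<in> X" "w \<in> W" "g u < g w \<and> g w < g v \<and> E u v"
  obtain w' where w': "w' \<in> W" "g v < g w'" "E v w'" using dom[OF *(2)] by blast
  have "\<not> E w v"
    using not_adj_walls_on_both_sides[OF ab X[OF *(2)], of w w'] * w' W(1) W(2)[of w] W(2)[of w'] W(3)[of w w']
    by blast
  then show "E u w"
    using wall_separates[OF ab X[OF *(1)] X[OF *(2)], of w] * W(1) W(2)[of w] by blast
qed

text \<open>The setting of the induction step on the clique number. The induction hypothesis
  \<open>smaller_cliques\<close> includes shortened flags \<open>r'\<close>, because cutting flags
  at needles is one of the ways to lower the clique number.\<close>

locale flag_step = flags V f r for V :: "'a set" and f r +
  fixes k c :: nat
  assumes k: "2 \<le> k"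
    and clique_bound: "\<And>K. \<lbrakk>K \<subseteq> V; pairwise_adjacent E K\<rbrakk> \<Longrightarrow> card K \<le> k"
    and smaller_cliques: "\<And>A r'. \<lbrakk>A \<subseteq> V; \<And>i. i \<in> A \<Longrightarrow> 0 \<le> r' i \<and> r' i \<le> r i;
      \<And>K. \<lbrakk>K \<subseteq> A; pairwise_adjacent (adj f r') K\<rbrakk> \<Longrightarrow> card K < k\<rbrakk> \<Longrightarrow> colorable (adj f r') A c"
begin

lemma mirror_flag_step: "flag_step V (mirror f) r k c"
proof -
  interpret mir: flags V "mirror f" r by (rule mirror_flags)
  show ?thesis
  proof
    show "2 \<le> k" by (rule k)
    show "card K \<le> k" if "K \<subseteq> V" "pairwise_adjacent mir.E K" for K
      using clique_bound[of K] that by (simp add: adj_mirror)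
    show "colorable (adj (mirror f) r') A c" if "A \<subseteq> V" "\<And>i. i \<in> A \<Longrightarrow> 0 \<le> r' i \<and> r' i \<le> r i"
      "\<And>K. \<lbrakk>K \<subseteq> A; pairwise_adjacent (adj (mirror f) r') K\<rbrakk> \<Longrightarrow> card K < k" for A r'
      using smaller_cliques[of A r'] that unfolding adj_mirror by blast
  qed
qed

section \<open>Largest cliques and their common neighbors\<close>

lemma ex_clique:
  assumes "A \<subseteq> V" "\<not> colorable E A c"
  shows "\<exists>K\<subseteq>A. pairwise_adjacent E K \<and> card K = k"
proof (rule ccontr)
  assume *: "\<not> ?thesis"
  have "card K < k" if "K \<subseteq> A" "pairwise_adjacent E K" for K
  proof -
    have "card K \<le> k" using clique_bound[of K] that assms(1) by auto
    moreover have "card K \<noteq> k" using * that by blast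
    ultimately show ?thesis by simp
  qed
  moreover have "0 \<le> r i \<and> r i \<le> r i" if "i \<in> A" for i using r_nonneg assms(1) that by auto
  ultimately show False using smaller_cliques[of A r] assms by blast
qed

lemma finite_subset_V: "A \<subseteq> V \<Longrightarrow> finite A"
  using finite_V finite_subset by blast

lemma pairwise_adjacent_insert:
  assumes "pairwise_adjacent E K" "\<And>x. x \<in> K \<Longrightarrow> E x w"
  shows "pairwise_adjacent E (insert w K)"
proof -
  have "E w x" if "x \<in> K" for x using assms(2)[OF that] adj_sym[of f r w x] by simp
  then show ?thesis using assms unfolding pairwise_adjacent_def by blast
qed

lemma colorable_dominated:
  assumes "A \<subseteq> V" "w \<in> V" "\<And>x. x \<in> A \<Longrightarrow> E x w"
  shows "colorable E A c"
proof (rule ccontr)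
  assume "\<not> ?thesis"
  then obtain K where K: "K \<subseteq> A" "pairwise_adjacent E K" "card K = k" using ex_clique assms(1) by blast
  have "w \<notin> K" using assms(3) K(1) adj_irrefl[of f r w] by blast
  moreover have "finite K" using finite_subset_V K(1) assms(1) by blast
  moreover have "card (insert w K) \<le> k"
  proof (rule clique_bound)
    show "pairwise_adjacent E (insert w K)" using pairwise_adjacent_insert K assms(3) by blast
  qed (use K assms in blast)
  ultimately show False using K(3) by simp
qed

text \<open>The common contradiction for walls and needles: \<open>K\<close> will be a clique of
  size \<open>k\<close> without its highest member.\<close>

lemma no_extension_by_two:
  assumes "K \<subseteq> V" "pairwise_adjacent E K" "card K = k - 1" "w \<in> V" "w' \<in> V" "E w w'"
    "\<And>x. x \<in> K \<Longrightarrow> E x w" "\<And>x. x \<in> K \<Longrightarrow> E x w'"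
  shows False
proof -
  have "pairwise_adjacent E (insert w K)" using pairwise_adjacent_insert assms by blast
  then have "pairwise_adjacent E (insert w' (insert w K))"
    by (rule pairwise_adjacent_insert) (use assms in blast)
  then have "card (insert w' (insert w K)) \<le> k" by (rule clique_bound[rotated]) (use assms in blast)
  moreover have "w \<notin> K" "w' \<notin> insert w K"
    using assms(6-8) adj_irrefl[of f r] by blast+
  moreover have "finite K" using finite_subset_V assms(1) by blast
  ultimately show False using assms(3) k by simp
qed

text \<open>\<open>u\<close> and \<open>v\<close> are the two highest members of the clique \<open>insert v K\<close> of size \<open>k\<close>.\<close>

lemma ex_clique_with_gap:
  assumes "X \<subseteq> V" "\<not> colorable E X (2 * (T + 1) * c)"
  obtains K u v where "K \<subseteq> X" "pairwise_adjacent E K" "card K = k - 1" "u \<in> K" "v \<in> X"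
    "\<And>x. x \<in> K \<Longrightarrow> E x v" "\<And>x. x \<in> K \<Longrightarrow> g x \<le> g u" "g u < g v"
    "\<not> colorable E {y \<in> X. g u < g y \<and> g y < g v} T"
proof -
  \<comment> \<open>With \<open>c\<close> as the remaining bound, \<open>C\<close> still contains a
    clique of size \<open>k\<close>, and all its edges are long, in particular the one between its
    two highest members.\<close>
  obtain C where C: "C \<subseteq> X" "\<not> colorable E C c"
    "\<And>a b. \<lbrakk>a \<in> C; b \<in> C; E a b; g a < g b\<rbrakk> \<Longrightarrow> \<not> colorable E {y \<in> X. g a < g y \<and> g y < g b} T"
    using ex_long_edges[of X g E T c, OF finite_subset_V[OF assms(1)] inj_on_ground[OF assms(1)] adj_irrefl assms(2)]
    by blast
  have "C \<subseteq> V" using C(1) assms(1) by blast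
  obtain L where L: "L \<subseteq> C" "pairwise_adjacent E L" "card L = k"
    using ex_clique C(2) \<open>C \<subseteq> V\<close> by blast
  have finL: "finite L" using L(1) \<open>C \<subseteq> V\<close> finite_subset_V by blast
  have "L \<noteq> {}" using L(3) k by auto
  obtain v where v: "v \<in> L" "Max (g ` L) = g v"
    using obtains_MAX[of L g] finL \<open>L \<noteq> {}\<close> by blast
  have vmax: "g x \<le> g v" if "x \<in> L" for x
  proof -
    have "g x \<in> g ` L" using that by blast
    then show ?thesis using finL Max_ge[of "g ` L" "g x"] v(2) by simp
  qed
  let ?K = "L - {v}"
  have finK: "finite ?K" using finL by blast
  have cardK: "card ?K = k - 1" using L(3) v(1) by simp
  then have "card ?K \<noteq> 0" using k by simp
  then have "?K \<noteq> {}" by (metis card.empty)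
  then obtain u where u: "u \<in> ?K" "Max (g ` ?K) = g u"
    using obtains_MAX[of ?K g] finK by blast
  have umax: "g x \<le> g u" if "x \<in> ?K" for x
  proof -
    have "g x \<in> g ` ?K" using that by blast
    then show ?thesis using finK Max_ge[of "g ` ?K" "g x"] u(2) by simp
  qed
  have Kv: "E x v" if "x \<in> ?K" for x using L(2) v(1) that unfolding pairwise_adjacent_def by blast
  have "g u \<le> g v" "u \<noteq> v" using vmax u(1) by auto
  moreover have "g u \<noteq> g v" using inj_ground[of u v] u(1) v(1) L(1) \<open>C \<subseteq> V\<close> \<open>u \<noteq> v\<close> by blast
  ultimately have uv: "g u < g v" by simp
  show thesis
  proof (rule that[of ?K u v])
    show "?K \<subseteq> X" "v \<in> X" using L(1) C(1) v(1) by blast+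
    show "pairwise_adjacent E ?K" using L(2) unfolding pairwise_adjacent_def by blast
    show "\<not> colorable E {y \<in> X. g u < g y \<and> g y < g v} T"
      using C(3)[of u v] u(1) v(1) L(1) Kv[OF u(1)] uv by blast
  qed (use cardK u(1) Kv umax uv in blast)+
qed

section \<open>Nested walls\<close>

text \<open>The first wall above \<open>x\<close> is always met by \<open>x\<close>, and it is
  \<open>w0\<close> for all of \<open>A\<close>; thus \<open>A\<close> lies in the neighborhood of
  one flag.\<close>

lemma colorable_before_common_wall:
  assumes "wall f r X W" "X \<subseteq> V" "W \<subseteq> V" "A \<subseteq> X" "w0 \<in> W"
    "\<And>x. x \<in> A \<Longrightarrow> g x < g w0" "\<And>x w. \<lbrakk>x \<in> A; w \<in> W; g x < g w\<rbrakk> \<Longrightarrow> g w0 \<le> g w"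
  shows "colorable E A c"
proof (rule colorable_dominated)
  fix x assume x: "x \<in> A"
  then obtain w where w: "w \<in> W" "g x < g w" "\<And>w'. \<lbrakk>w' \<in> W; g x < g w'; g w' \<le> g w\<rbrakk> \<Longrightarrow> E x w'"
    using assms(1,4) unfolding wall_def by blast
  then show "E x w0" using assms(5) assms(6)[OF x] assms(7)[OF x] by blast
qed (use assms in blast)+

lemma colorable_before_gap:
  assumes "wall f r X W" "X \<subseteq> V" "W \<subseteq> V" "A \<subseteq> X"
    "\<And>x w. \<lbrakk>x \<in> A; w \<in> W; g x < g w\<rbrakk> \<Longrightarrow> t \<le> g w" "\<And>x. x \<in> A \<Longrightarrow> g x < t"
  shows "colorable E A c"
proof (cases "A = {}")
  case True
  then show ?thesis by simp
next
  case False
  let ?W = "{w \<in> W. t \<le> g w}"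
  obtain x where "x \<in> A" using False by blast
  then obtain w where "w \<in> W" "g x < g w" using assms(1,4) unfolding wall_def by blast
  then have "w \<in> ?W" using assms(5) \<open>x \<in> A\<close> by blast
  then have ne: "?W \<noteq> {}" by blast
  have fin: "finite ?W" using finite_subset_V assms(3) by simp
  obtain w0 where w0: "w0 \<in> ?W" "Min (g ` ?W) = g w0" using obtains_MIN[of ?W g] ne fin by blast
  show ?thesis
  proof (rule colorable_before_common_wall[OF assms(1-4), of w0])
    show "w0 \<in> W" using w0 by blast
    show "g x < g w0" if "x \<in> A" for x using assms(6)[OF that] w0(1) by simp
    show "g w0 \<le> g w" if "x \<in> A" "w \<in> W" "g x < g w" for x w
    proof -
      have "g w \<in> g ` ?W" using assms(5) that by blast
      then show ?thesis using w0(2) fin Min_le[of "g ` ?W" "g w"] by simp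
    qed
  qed
qed

text \<open>A wall of either system that starts between \<open>u\<close> and \<open>v\<close> is met
  by all of \<open>K\<close>, since each member of \<open>K\<close> meets \<open>v\<close> beyond
  it. A member of \<open>W2\<close> lies in \<open>X1\<close> and so meets the next wall of
  \<open>W1\<close> above it; \<open>no_extension_by_two\<close> forbids that both start in the
  gap.\<close>

lemma colorable_nested_walls:
  assumes "X1 \<subseteq> V" "W1 \<subseteq> V" "X2 \<subseteq> X1" "W2 \<subseteq> X1" "wall f r X1 W1" "wall f r X2 W2"
  shows "colorable E X2 (2 * (3 * c + 1) * c)"
proof (rule ccontr)
  assume nc: "\<not> ?thesis"
  have V: "X2 \<subseteq> V" "W2 \<subseteq> V" using assms by blast+
  obtain K u v where K: "K \<subseteq> X2" "pairwise_adjacent E K" "card K = k - 1" "u \<in> K" "v \<in> X2"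
    "\<And>x. x \<in> K \<Longrightarrow> E x v" "\<And>x. x \<in> K \<Longrightarrow> g x \<le> g u" "g u < g v"
    "\<not> colorable E {y \<in> X2. g u < g y \<and> g y < g v} (3 * c)"
    using ex_clique_with_gap[OF V(1) nc] by blast
  let ?Y = "{y \<in> X2. g u < g y \<and> g y < g v}"
  have no_pair: "\<not> E w2 w1" if w: "w2 \<in> W2" "w1 \<in> W1" "g u < g w2" "g w2 < g v" "g u < g w1" "g w1 < g v" for w1 w2
  proof
    assume adj: "E w2 w1"
    have cross: "E x w2" "E x w1" if "x \<in> K" for x
    proof -
      have "g x < g w2" "g x < g w1" using K(7)[OF that] w by auto
      then show "E x w2" "E x w1"
        using assms(3,5,6) w K(1,5) K(6)[OF that] that unfolding wall_def by blast+
    qed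
    show False
      by (rule no_extension_by_two[of K w2 w1]) (use K V assms(2) w adj cross in blast)+
  qed
  \<comment> \<open>Flags with no wall of \<open>W2\<close>, or none of \<open>W1\<close>, between
    them and \<open>v\<close> have a common next wall of that system. The third class has both; each
    class costs \<open>c\<close> colors.\<close>
  define Y1 where "Y1 = {y \<in> ?Y. \<forall>w\<in>W2. g y < g w \<longrightarrow> g v \<le> g w}"
  define Y2 where "Y2 = {y \<in> ?Y. \<forall>w\<in>W1. g y < g w \<longrightarrow> g v \<le> g w}"
  define Y3 where "Y3 = ?Y - Y1 - Y2"
  have "colorable E Y1 c"
    by (rule colorable_before_gap[of X2 W2 _ "g v"]) (use assms V in \<open>auto simp: Y1_def\<close>)
  moreover have "colorable E Y2 c"
    by (rule colorable_before_gap[of X1 W1 _ "g v"]) (use assms V in \<open>auto simp: Y2_def\<close>)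
  moreover have "colorable E Y3 c"
  proof (cases "Y3 = {}")
    case True
    then show ?thesis by simp
  next
    case False
    let ?W = "{w \<in> W2. g u < g w \<and> g w < g v}"
    have in_W: "\<exists>w\<in>?W. g y < g w" if "y \<in> Y3" for y using that by (force simp: Y3_def Y1_def)
    then have ne: "?W \<noteq> {}" using False by blast
    have fin: "finite ?W" using finite_subset_V V by simp
    obtain w0 where w0: "w0 \<in> ?W" "Min (g ` ?W) = g w0" using obtains_MIN[of ?W g] ne fin by blast
    have min: "g w0 \<le> g w" if "w \<in> ?W" for w
    proof -
      have "g w \<in> g ` ?W" using that by blast
      then show ?thesis using w0(2) fin Min_le[of "g ` ?W" "g w"] by simp
    qed
    have no_W1_after: "\<not> (g w2 < g w1 \<and> g w1 < g v)" if "w2 \<in> ?W" "w1 \<in> W1" for w1 w2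
    proof
      assume *: "g w2 < g w1 \<and> g w1 < g v"
      have "w2 \<in> X1" using that assms(4) by blast
      then obtain w where w: "w \<in> W1" "g w2 < g w"
        "\<And>w'. \<lbrakk>w' \<in> W1; g w2 < g w'; g w' \<le> g w\<rbrakk> \<Longrightarrow> E w2 w'"
        using assms(5) unfolding wall_def by blast
      show False
      proof (cases "g w1 \<le> g w")
        case True
        then have "E w2 w1" using w * that by blast
        then show False using no_pair[of w2 w1] that * by auto
      next
        case False
        then have "E w2 w" "g w < g v" using w * by auto
        then show False using no_pair[of w2 w] that w by auto
      qed
    qed
    show ?thesis
    proof (rule colorable_before_common_wall[OF assms(6) V, of Y3 w0])
      show "Y3 \<subseteq> X2" by (auto simp: Y3_def)
      show "w0 \<in> W2" using w0 by blast
      \<comment> \<open>Some wall of \<open>W1\<close> starts between \<open>y\<close> and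
        \<open>v\<close>, and no such wall starts above \<open>w0\<close>. Hence \<open>w0\<close>
        is the first wall of \<open>W2\<close> above every flag in \<open>Y3\<close>.\<close>
      show "g y < g w0" if "y \<in> Y3" for y
      proof -
        have "y \<in> ?Y" "y \<notin> Y2" using that unfolding Y3_def by blast+
        then have "\<exists>w\<in>W1. g y < g w \<and> \<not> g v \<le> g w" unfolding Y2_def by blast
        then obtain w1 where w1: "w1 \<in> W1" "g y < g w1" "g w1 < g v" by (auto simp: not_le)
        then have "g w1 \<le> g w0" using no_W1_after[OF w0(1), of w1] by auto
        then show ?thesis using w1 by simp
      qed
      show "g w0 \<le> g w" if "y \<in> Y3" "w \<in> W2" "g y < g w" for y w
      proof (cases "g w < g v")
        case True
        then show ?thesis using min[of w] that by (auto simp: Y3_def)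
      qed (use w0 in auto)
    qed
  qed
  ultimately have "colorable E (Y1 \<union> Y2 \<union> Y3) (c + c + c)" by (intro colorable_Un)
  moreover have "?Y \<subseteq> Y1 \<union> Y2 \<union> Y3" by (auto simp: Y3_def)
  ultimately have "colorable E ?Y (3 * c)" by (rule colorable_mono) auto
  then show False using K(9) by blast
qed

end

section \<open>Nested needles\<close>

context flags
begin

text \<open>The abscissa at which \<open>i\<close> and \<open>j\<close> meet; arbitrary if they do not.\<close>

definition tm :: "'a \<Rightarrow> 'a \<Rightarrow> real" where
  "tm i j = (SOME t. 0 \<le> t \<and> t \<le> r i \<and> t \<le> r j \<and> f i t = f j t)"

lemma tm:
  assumes "E i j"
  shows "0 \<le> tm i j" "tm i j \<le> r i" "tm i j \<le> r j" "f i (tm i j) = f j (tm i j)"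
proof -
  have "\<exists>t. 0 \<le> t \<and> t \<le> r i \<and> t \<le> r j \<and> f i t = f j t" using assms by (simp add: adj_def)
  from someI_ex[OF this] show "0 \<le> tm i j" "tm i j \<le> r i" "tm i j \<le> r j" "f i (tm i j) = f j (tm i j)"
    unfolding tm_def[symmetric] by auto
qed

section \<open>Order before and after the meeting point\<close>

lemma tm_le:
  assumes "i \<in> V" "j \<in> V" "g i < g j" "0 \<le> x" "x \<le> r i" "x \<le> r j" "f j x \<le> f i x"
  shows "E i j" "tm i j \<le> x"
proof -
  show "E i j" using adjI assms by blast
  note t = tm[OF this]
  show "tm i j \<le> x"
  proof (rule ccontr)
    assume "\<not> tm i j \<le> x"
    then have "f j (tm i j) < f i (tm i j)"
      using swapped_mono[of i j x "tm i j"] assms t by simp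
    then show False using t by simp
  qed
qed

lemma less_before_tm:
  assumes "i \<in> V" "j \<in> V" "g i < g j" "0 \<le> x" "x < tm i j" "E i j"
  shows "f i x < f j x"
proof (rule ccontr)
  assume "\<not> f i x < f j x"
  then have "tm i j \<le> x" using tm_le(2)[of i j x] tm[OF assms(6)] assms by simp
  then show False using assms(5) by simp
qed

lemma le_after_tm:
  assumes "i \<in> V" "j \<in> V" "g i < g j" "tm i j \<le> x" "x \<le> r i" "x \<le> r j" "E i j"
  shows "f j x \<le> f i x"
proof (cases "tm i j = x")
  case True
  then show ?thesis using tm[OF assms(7)] by simp
next
  case False
  then have "tm i j < x" using assms(4) by simp
  then have "f j x < f i x"
    using order_swapped[of i j "tm i j" x] tm[OF assms(7)] assms by simp
  then show ?thesis by simp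
qed

lemma tm_unique:
  assumes "i \<in> V" "j \<in> V" "g i < g j" "0 \<le> t" "t \<le> r i" "t \<le> r j" "f i t = f j t"
  shows "t = tm i j"
proof -
  have *: "E i j" "tm i j \<le> t" using tm_le[of i j t] assms by simp_all
  show ?thesis
  proof (rule ccontr)
    assume "t \<noteq> tm i j"
    then have "tm i j < t" using * by simp
    then have "f j t < f i t"
      using order_swapped[of i j "tm i j" t] tm[OF *(1)] assms by simp
    then show False using assms(7) by simp
  qed
qed

text \<open>When \<open>w\<close> reaches \<open>v\<close>, \<open>u\<close> is still at or below
  \<open>v\<close>, so \<open>w\<close> has passed \<open>u\<close>.\<close>

lemma early_hit_is_shared:
  assumes "w \<in> V" "u \<in> V" "v \<in> V" "g w < g u" "g u < g v" "E u v" "E w v" "tm w v \<le> tm u v"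
  shows "E w u"
proof -
  let ?t = "tm w v"
  note t = tm[OF assms(7)] and \<xi> = tm[OF assms(6)]
  have "f u ?t \<le> f v ?t"
  proof (cases "?t = tm u v")
    case False
    then show ?thesis using less_before_tm[of u v ?t] assms t by simp
  qed (use \<xi> in simp)
  then show ?thesis using adjI[of w u ?t] assms t \<xi> by simp
qed

text \<open>If \<open>w'\<close> did not start below \<open>w\<close>, it would be at or above
  \<open>w\<close> when \<open>w\<close> meets \<open>u\<close>, hence past \<open>u\<close> from
  then on. Where \<open>u\<close> meets \<open>v\<close> it would have reached \<open>v\<close> too,
  which is earlier than assumed.\<close>

lemma early_hit_before_late_hit:
  assumes "w \<in> V" "w' \<in> V" "u \<in> V" "v \<in> V" "g w < g u" "g w' < g u" "g u < g v" "\<not> E w w'"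
    "E u v" "E w u" "tm w u \<le> tm u v" "E w' v" "tm u v < tm w' v"
  shows "g w' < g w"
proof (rule ccontr)
  let ?t = "tm u v" and ?s = "tm w u"
  assume n: "\<not> g w' < g w"
  note \<xi> = tm[OF assms(9)] and s = tm[OF assms(10)] and t' = tm[OF assms(12)]
  have w': "f w' ?t < f v ?t" using less_before_tm[of w' v ?t] assms \<xi> by simp
  have "f w ?s \<le> f w' ?s"
  proof (cases "w = w'")
    case False
    then have "g w < g w'" using n inj_ground[of w w'] assms(1,2) by fastforce
    then show ?thesis using nonadj_less[of w w' ?s] assms \<xi> s t' by simp
  qed simp
  then have "f u ?s \<le> f w' ?s" using s by simp
  then have *: "E w' u" "tm w' u \<le> ?s" using tm_le[of w' u ?s] assms s t' \<xi> by simp_all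
  then have "f u ?t \<le> f w' ?t"
    using le_after_tm[of w' u ?t] assms \<xi> t' by simp
  then show False using w' \<xi> by simp
qed

text \<open>When \<open>w\<close> meets \<open>u\<close>, \<open>u\<close> has already risen to or
  above \<open>v\<close>, which is still alive.\<close>

lemma late_hit_is_shared:
  assumes "w \<in> V" "u \<in> V" "v \<in> V" "g w < g u" "g u < g v" "E u v" "E w u" "tm u v \<le> tm w u" "tm w u \<le> r v"
  shows "E w v"
proof -
  let ?s = "tm w u"
  note s = tm[OF assms(7)]
  have "f v ?s \<le> f u ?s" using le_after_tm[of u v ?s] assms s by simp
  then show ?thesis using adjI[of w v ?s] assms s by simp
qed

text \<open>\<open>w\<close> outlives \<open>v\<close>, so it is alive where the lower
  \<open>w'\<close> reaches \<open>v\<close>, and there it lies above \<open>w'\<close>.\<close>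

lemma hit_below_lower_needle:
  assumes "w \<in> V" "w' \<in> V" "v \<in> V" "g w' < g w" "g w < g v" "\<not> E w' w" "E w u" "r v < tm w u" "E w' v"
  shows "E w v"
proof -
  let ?t = "tm w' v"
  note s = tm[OF assms(7)] and t = tm[OF assms(9)]
  have "f w' ?t < f w ?t" using nonadj_less[of w' w ?t] assms s t by simp
  then show ?thesis using adjI[of w v ?t] assms s t by simp
qed

end

lemma needleD:
  assumes "needle f r X W"
  shows "\<And>w w'. \<lbrakk>w \<in> W; w' \<in> W\<rbrakk> \<Longrightarrow> \<not> adj f r w w'" "\<And>w x. \<lbrakk>w \<in> W; x \<in> X\<rbrakk> \<Longrightarrow> f w 0 < f x 0"
    "\<And>x. x \<in> X \<Longrightarrow> \<exists>w\<in>W. adj f r w x"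
  using assms adj_sym[of f r] unfolding needle_def by blast+

lemma ex_min_image:
  fixes key :: "'a \<Rightarrow> real"
  assumes "finite A" "A \<noteq> {}"
  obtains x where "x \<in> A" "\<And>y. y \<in> A \<Longrightarrow> key x \<le> key y"
proof -
  obtain x where x: "x \<in> A" "Min (key ` A) = key x" using obtains_MIN[of A key] assms by blast
  have "key x \<le> key y" if "y \<in> A" for y
  proof -
    have "key y \<in> key ` A" using that by blast
    then show ?thesis using Min_le[of "key ` A" "key y"] assms(1) x(2) by simp
  qed
  with x(1) show thesis using that by blast
qed

context flag_step
begin

lemma card_less_if_common_neighbour:
  assumes "K \<subseteq> V" "pairwise_adjacent E K" "w \<in> V" "\<And>x. x \<in> K \<Longrightarrow> E x w"
  shows "card K < k"
proof -
  have "card (insert w K) \<le> k"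
    by (rule clique_bound) (use assms pairwise_adjacent_insert in blast)+
  moreover have "w \<notin> K" using assms(4) adj_irrefl[of f r w] by blast
  moreover have "finite K" using finite_subset_V assms(1) by blast
  ultimately show ?thesis by simp
qed

text \<open>
  Cutting each flag at its first \<open>B\<close>-needle leaves only cliques that share a needle. In a class
  without edges of the truncated family, the first needle met by the highest member of a clique
  meets the whole clique: otherwise that member meets all its needles, in particular one of \<open>D\<close>,
  only after crossing a flag that has already met one of \<open>B\<close>.
\<close>

lemma colorable_three_needles:
  assumes V: "Y \<subseteq> V" "A \<subseteq> V" "B \<subseteq> V" "D \<subseteq> V"
    and needles: "needle f r Y A" "needle f r Y B" "needle f r Y D"
    and indep: "\<And>w w'. \<lbrakk>w \<in> A \<union> B \<union> D; w' \<in> A \<union> B \<union> D\<rbrakk> \<Longrightarrow> \<not> E w w'"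
    and AB: "\<And>a b. \<lbrakk>a \<in> A; b \<in> B\<rbrakk> \<Longrightarrow> g a < g b" and BD: "\<And>b d. \<lbrakk>b \<in> B; d \<in> D\<rbrakk> \<Longrightarrow> g b < g d"
  shows "colorable E Y (c * c)"
proof -
  have "\<exists>b. b \<in> B \<and> E b y \<and> (\<forall>b'\<in>B. E b' y \<longrightarrow> tm b y \<le> tm b' y)" if "y \<in> Y" for y
  proof -
    let ?B = "{b \<in> B. E b y}"
    have "?B \<noteq> {}" using needleD(3)[OF needles(2) that] by blast
    moreover have "finite ?B" using finite_subset_V V by simp
    ultimately obtain b where "b \<in> ?B" "\<And>b'. b' \<in> ?B \<Longrightarrow> tm b y \<le> tm b' y"
      using ex_min_image[of ?B "\<lambda>b. tm b y"] by blast
    then show ?thesis by blast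
  qed
  then obtain \<beta> where \<beta>: "\<And>y. y \<in> Y \<Longrightarrow> \<beta> y \<in> B" "\<And>y. y \<in> Y \<Longrightarrow> E (\<beta> y) y"
    "\<And>y b. \<lbrakk>y \<in> Y; b \<in> B; E b y\<rbrakk> \<Longrightarrow> tm (\<beta> y) y \<le> tm b y"
    by metis
  define r' where "r' y = tm (\<beta> y) y" for y
  have r': "0 \<le> r' y" "r' y \<le> r y" if "y \<in> Y" for y using tm[OF \<beta>(2)[OF that]] by (auto simp: r'_def)
  have adj'D: "E u v" "tm u v \<le> r' u" if uv: "u \<in> Y" "v \<in> Y" "g u < g v" "adj f r' u v" for u v
  proof -
    obtain t where t: "0 \<le> t" "t \<le> r' u" "t \<le> r' v" "f u t = f v t" using uv(4) by (auto simp: adj_def)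
    then have le: "t \<le> r u" "t \<le> r v" using r' uv by force+
    then have "t = tm u v" using tm_unique[of u v t] uv V t by blast
    then show "tm u v \<le> r' u" using t by simp
    show "E u v" using adjI[of u v t] uv V t le by auto
  qed
  have adj'_sub: "E u v" if "u \<in> Y" "v \<in> Y" "adj f r' u v" for u v
  proof -
    have "u \<noteq> v" using that(3) by (simp add: adj_def)
    then have "g u \<noteq> g v" using inj_ground V that by blast
    then consider "g u < g v" | "g v < g u" by linarith
    then show ?thesis
      using adj'D(1)[of u v] adj'D(1)[of v u] that adj_sym[of f r u v] adj_sym[of f r' u v] by cases auto
  qed
  have "colorable (adj f r') Y c"
  proof (rule smaller_cliques)
    show "0 \<le> r' i \<and> r' i \<le> r i" if "i \<in> Y" for i using r' that by blast
    fix K assume K: "K \<subseteq> Y" "pairwise_adjacent (adj f r') K"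
    show "card K < k"
    proof (cases "K = {}")
      case True
      then show ?thesis using k by simp
    next
      case False
      have "finite K" using finite_subset_V K V by blast
      \<comment> \<open>The other members of \<open>K\<close> meet the lowest one, \<open>u\<close>,
        before it is cut. When the cutting needle arrives from below, \<open>u\<close> is above
        them, so the needle has crossed those that are still alive.\<close>
      then obtain u where u: "u \<in> K" "\<And>x. x \<in> K \<Longrightarrow> g u \<le> g x"
        using ex_min_image[of K g] False by blast
      have uY: "u \<in> Y" using u K by blast
      let ?b = "\<beta> u"
      have b: "?b \<in> B" "E ?b u" "?b \<in> V" using \<beta> uY V by blast+
      have "E ?b x" if x: "x \<in> K" for x
      proof (cases "x = u")
        case False
        have xY: "x \<in> Y" using x K by blast
        have "g u < g x" using u(2)[OF x] inj_ground[of u x] V uY xY False by fastforce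
        moreover have "adj f r' u x"
          using K(2)[unfolded pairwise_adjacent_def, rule_format, OF u(1) x] False by simp
        ultimately have ux: "E u x" "tm u x \<le> tm ?b u" "g u < g x"
          using adj'D[OF uY xY] unfolding r'_def by simp_all
        have bu: "g ?b < g u" "g ?b < g x" using needleD(2)[OF needles(2)] b uY xY by blast+
        obtain a where a: "a \<in> A" "E a x" using needleD(3)[OF needles(1) xY] by blast
        show ?thesis
        \<comment> \<open>If \<open>x\<close> ends before \<open>?b\<close> reaches
          \<open>u\<close>, the needle \<open>a\<close> below \<open>?b\<close> shows that
          \<open>?b\<close> has crossed \<open>x\<close> as well.\<close>
        proof (cases "tm ?b u \<le> r x")
          case True
          then show ?thesis using late_hit_is_shared[of ?b u x] b ux bu uY xY V by blast
        next
          case False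
          then show ?thesis
            using hit_below_lower_needle[of ?b a x u] a b bu xY V AB[of a ?b] indep[of a ?b] by auto
        qed
      qed (use b in simp)
      then have "E x ?b" if "x \<in> K" for x using that adj_sym[of f r x ?b] by simp
      moreover have "pairwise_adjacent E K"
        using K adj'_sub unfolding pairwise_adjacent_def by blast
      ultimately show ?thesis
        using card_less_if_common_neighbour[of K ?b] K V b by blast
    qed
  qed (rule V)
  then show ?thesis
  proof (rule colorable_product)
    fix Z assume Z: "Z \<subseteq> Y" and nadj: "\<And>x y. \<lbrakk>x \<in> Z; y \<in> Z\<rbrakk> \<Longrightarrow> \<not> adj f r' x y"
    show "colorable E Z c"
    proof (rule smaller_cliques)
      show "Z \<subseteq> V" using Z V by blast
      show "0 \<le> r i \<and> r i \<le> r i" if "i \<in> Z" for i using that Z V r_nonneg by auto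
      fix K assume K: "K \<subseteq> Z" "pairwise_adjacent E K"
      show "card K < k"
      proof (cases "K = {}")
        case True
        then show ?thesis using k by simp
      next
        case False
        have KV: "K \<subseteq> Y" "K \<subseteq> V" using K Z V by blast+
        have "finite K" using finite_subset_V KV by blast
        then obtain v where v: "v \<in> K" "\<And>x. x \<in> K \<Longrightarrow> - g v \<le> - g x"
          using ex_min_image[of K "\<lambda>x. - g x"] False by blast
        let ?W = "{w \<in> A \<union> B \<union> D. E w v}"
        have vY: "v \<in> Y" using v KV by blast
        have "?W \<noteq> {}" using needleD(3)[OF needles(1) vY] by blast
        moreover have "finite ?W" using finite_subset_V V by simp
        ultimately obtain w where w: "w \<in> ?W" "\<And>w'. w' \<in> ?W \<Longrightarrow> tm w v \<le> tm w' v"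
          using ex_min_image[of ?W "\<lambda>w. tm w v"] by blast
        have wV: "w \<in> V" using w(1) V by blast
        have below: "g w' < g x" if "w' \<in> A \<union> B \<union> D" "x \<in> Y" for w' x
          using that needleD(2)[OF needles(1)] needleD(2)[OF needles(2)] needleD(2)[OF needles(3)] by blast
        have "E w u" if u: "u \<in> K" for u
        proof (cases "u = v")
          case False
          have uY: "u \<in> Y" using u KV by blast
          have uv: "g u < g v" using v(2)[OF u] inj_ground[of u v] KV u v(1) False by fastforce
          have adj: "E u v"
            using K(2)[unfolded pairwise_adjacent_def, rule_format, OF u v(1)] False by simp
          have "tm w v \<le> tm u v"
          proof (rule ccontr)
            assume n: "\<not> tm w v \<le> tm u v"
            have late: "tm u v < tm w' v" if "w' \<in> A \<union> B \<union> D" "E w' v" for w'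
              using w(2)[of w'] that n by simp
            \<comment> \<open>\<open>v\<close> is not yet cut where it meets \<open>u\<close>. Since
              the truncated flags do not meet, \<open>u\<close> is already cut there, so its needle
              \<open>\<beta> u\<close> came early while the needle \<open>d\<close> of
              \<open>v\<close> is late; this puts \<open>d\<close> below
              \<open>\<beta> u\<close>.\<close>
            have "tm u v < r' v" using late[of "\<beta> v"] \<beta>[OF vY] by (auto simp: r'_def)
            moreover have "\<not> adj f r' u v" using nadj u v(1) K(1) by blast
            moreover have "u \<noteq> v" "0 \<le> tm u v" "f u (tm u v) = f v (tm u v)" using uv tm[OF adj] by auto
            ultimately have "r' u < tm u v" unfolding adj_def by force
            moreover obtain d where d: "d \<in> D" "E d v" using needleD(3)[OF needles(3) vY] by blast
            ultimately have "g d < g (\<beta> u)"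
              using early_hit_before_late_hit[of "\<beta> u" d u v] \<beta>(1,2)[OF uY] V uY vY uv adj
                below[of "\<beta> u" u] below[of d u] indep[of "\<beta> u" d] late[of d]
              by (auto simp: r'_def)
            then show False using BD[of "\<beta> u" d] \<beta>(1)[OF uY] d(1) by simp
          qed
          then show ?thesis
            using early_hit_is_shared[of w u v] wV uY vY V uv adj w(1) below[of w u] by blast
        qed (use w in blast)
        then have "E x w" if "x \<in> K" for x using that adj_sym[of f r x w] by simp
        then show ?thesis using card_less_if_common_neighbour[of K w] K KV wV by blast
      qed
    qed
  qed
qed

lemma colorable_neighbours:
  assumes "finite L" "L \<subseteq> V" "A \<subseteq> V" "\<And>y. y \<in> A \<Longrightarrow> \<exists>x\<in>L. E y x"
  shows "colorable E A (card L * c)"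
  using assms
proof (induction L arbitrary: A rule: finite_induct)
  case empty
  then have "A = {}" by blast
  then show ?case by simp
next
  case (insert x L)
  have "colorable E ({y \<in> A. E y x} \<union> {y \<in> A. \<not> E y x}) (c + card L * c)"
  proof (rule colorable_Un)
    show "colorable E {y \<in> A. E y x} c" by (rule colorable_dominated[of _ x]) (use insert in blast)+
    show "colorable E {y \<in> A. \<not> E y x} (card L * c)" by (rule insert.IH) (use insert in blast)+
  qed
  then have "colorable E A (c + card L * c)" by (rule colorable_subset) blast
  then show ?case using insert.hyps by simp
qed

lemma needle_subset: "needle f r X W \<Longrightarrow> Y \<subseteq> X \<Longrightarrow> needle f r Y W"
  unfolding needle_def by blast

text \<open>Of the chromatic number in the gap, \<open>k * c\<close> pays for the neighborhoods of
  the \<open>k\<close> clique members and \<open>c * c\<close> for the flags that avoid the clique.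
  Needles that reach the latter cross all of \<open>K\<close>, so they are pairwise disjoint across
  the three systems.\<close>

lemma colorable_nested_needles:
  assumes V: "X \<subseteq> V" "W1 \<subseteq> V" "W2 \<subseteq> V" "W3 \<subseteq> V"
    and needles: "needle f r X W1" "needle f r X W2" "needle f r X W3"
    and lt: "\<And>a b. \<lbrakk>a \<in> W1; b \<in> W2\<rbrakk> \<Longrightarrow> g a < g b" "\<And>a b. \<lbrakk>a \<in> W2; b \<in> W3\<rbrakk> \<Longrightarrow> g a < g b"
  shows "colorable E X (2 * (c * c + k * c + 1) * c)"
proof (rule ccontr)
  assume nc: "\<not> ?thesis"
  obtain K u v where K: "K \<subseteq> X" "pairwise_adjacent E K" "card K = k - 1" "u \<in> K" "v \<in> X"
    "\<And>x. x \<in> K \<Longrightarrow> E x v" "\<And>x. x \<in> K \<Longrightarrow> g x \<le> g u" "g u < g v"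
    "\<not> colorable E {y \<in> X. g u < g y \<and> g y < g v} (c * c + k * c)"
    using ex_clique_with_gap[OF V(1) nc] by blast
  let ?Y0 = "{y \<in> X. g u < g y \<and> g y < g v}"
  define Y where "Y = {y \<in> ?Y0. \<forall>x\<in>insert v K. \<not> E y x}"
  have YX: "Y \<subseteq> X" by (auto simp: Y_def)
  have finK: "finite K" using finite_subset_V K(1) V by blast
  have "v \<notin> K" using K(6) adj_irrefl[of f r v] by blast
  then have card: "card (insert v K) = k" using finK K(3) k by simp
  have rest: "colorable E (?Y0 - Y) (card (insert v K) * c)"
    by (rule colorable_neighbours) (use finK K V in \<open>auto simp: Y_def\<close>)
  have ncY: "\<not> colorable E Y (c * c)"
  proof
    assume "colorable E Y (c * c)"
    then have "colorable E (Y \<union> (?Y0 - Y)) (c * c + k * c)"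
      using rest unfolding card by (rule colorable_Un)
    then have "colorable E ?Y0 (c * c + k * c)" by (rule colorable_subset) blast
    then show False using K(9) by blast
  qed
  define R where "R W = {w \<in> W. \<exists>y\<in>Y. E y w}" for W
  \<comment> \<open>\<open>y\<close> is trapped by \<open>v\<close> together with any member
    \<open>x\<close> of \<open>K\<close>, not only with \<open>u\<close>.\<close>
  have cross: "E x w" if "x \<in> K" "w \<in> V" "\<And>y. y \<in> X \<Longrightarrow> g w < g y" "y \<in> Y" "E y w" for x w y
  proof -
    have "trapped x v y"
      using that(1,4) K(7)[OF that(1)] V unfolding trapped_def Y_def by force
    then show ?thesis
      using enters_from_below[of x v y w] that K V by blast
  qed
  have nadj: "\<not> E w w'" if w: "w \<in> W1 \<union> W2 \<union> W3" "w' \<in> W1 \<union> W2 \<union> W3" "y \<in> Y" "E y w" "y' \<in> Y" "E y' w'" for w w' y y'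
  proof
    assume adj: "E w w'"
    have V': "w \<in> V" "w' \<in> V" using w V by blast+
    have below: "g w < g x" "g w' < g x" if "x \<in> X" for x
      using w(1,2) that needleD(2)[OF needles(1)] needleD(2)[OF needles(2)] needleD(2)[OF needles(3)] by blast+
    show False
    proof (rule no_extension_by_two[of K w w'])
      show "K \<subseteq> V" using K V by blast
      show "E x w" if "x \<in> K" for x using cross[OF that V'(1) below(1) w(3,4)] .
      show "E x w'" if "x \<in> K" for x using cross[OF that V'(2) below(2) w(5,6)] .
    qed (use K V' adj in blast)+
  qed
  have needle_R: "needle f r Y (R W)" if "needle f r X W" for W
    using that YX unfolding needle_def R_def by blast
  have "colorable E Y (c * c)"
  proof (rule colorable_three_needles[of Y "R W1" "R W2" "R W3"])
    show "\<not> E w w'" if w: "w \<in> R W1 \<union> R W2 \<union> R W3" "w' \<in> R W1 \<union> R W2 \<union> R W3" for w w'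
    proof -
      obtain y y' where "w \<in> W1 \<union> W2 \<union> W3" "w' \<in> W1 \<union> W2 \<union> W3" "y \<in> Y" "E y w" "y' \<in> Y" "E y' w'"
        using w unfolding R_def by blast
      then show ?thesis using nadj by blast
    qed
  qed (use V YX needle_R needles lt in \<open>auto simp: R_def\<close>)
  then show False using ncY by blast
qed

end

section \<open>Coloring flags\<close>

text \<open>Numerical tags make the four situations accessible to the pigeonhole principle; tags 2
  and 3 are the reflections of 0 and 1.\<close>

definition dominates :: "nat \<Rightarrow> ('a \<Rightarrow> real \<Rightarrow> real) \<Rightarrow> ('a \<Rightarrow> real) \<Rightarrow> 'a set \<Rightarrow> 'a set \<Rightarrow> bool" where
  "dominates t f r X W \<longleftrightarrow> (if t = 0 then needle f r X W else if t = 1 then wall f r X W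
     else if t = 2 then needle (mirror f) r X W else wall (mirror f) r X W)"

text \<open>\<open>2 * c\<close> pays for the neighborhoods of the trapping pair, and
  \<open>8 * c * m\<close> for four positions of a predecessor times \<open>2 * c\<close> colors
  that make predecessors independent. The outer 4 is 2 for the parity of layers times 2 from
  \<open>ex_long_edges\<close>.\<close>

definition layer_bound :: "nat \<Rightarrow> nat \<Rightarrow> nat" where
  "layer_bound c m = 4 * (2 * c + 8 * c * m + 1)"

text \<open>Among nine rounds with four possible tags, three share a tag. The starting value exceeds
  neither bound for nested systems by more than the other, so it covers both.\<close>

definition flag_bound :: "nat \<Rightarrow> nat \<Rightarrow> nat" where
  "flag_bound k c = (layer_bound c ^^ 9) (2 * (3 * c + 1) * c + 2 * (c * c + k * c + 1) * c)"

context flag_step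
begin

text \<open>
  In a distance layer of large chromatic number, two crossing flags trap many others; the
  predecessors of the trapped flags in the previous layer are connected to the lowest flag of
  their component outside the trap, so they cross one of the two.
\<close>

lemma ex_trapping_pair:
  assumes "X \<subseteq> V" "\<not> colorable E X (4 * (2 * c + n + 1))"
  obtains a b Y where "a \<in> V" "b \<in> V" "E a b" "Y \<subseteq> X" "\<And>y. y \<in> Y \<Longrightarrow> trapped a b y"
    "\<not> colorable E Y n"
    "\<And>y. y \<in> Y \<Longrightarrow> \<exists>z\<in>X. E y z \<and> (E z a \<or> E z b) \<and> z \<noteq> a \<and> z \<noteq> b"
proof -
  have fin: "finite X" using finite_subset_V assms(1) by blast
  have symE: "E y x" if "E x y" for x y using that adj_sym[of f r x y] by simp
  have nc0: "\<not> colorable E X (2 * (2 * (2 * c + n + 1) * 1))"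
  proof -
    have "2 * (2 * (2 * c + n + 1) * 1) = 4 * (2 * c + n + 1)" by (simp only: mult_1_right)
    with assms(2) show ?thesis by (simp only: not_False_eq_True simp_thms)
  qed
  obtain \<rho> S d where "distance_layers E X g \<rho> S" and nc: "\<not> colorable E (S d) (2 * (2 * c + n + 1) * 1)"
    using ex_distance_layer[where key = g, OF fin symE nc0] by blast
  note S = distance_layersD[OF this(1)]
  have SV: "S i \<subseteq> V" for i using S(2) assms(1) by blast
  \<comment> \<open>Failing to be 1-colorable means having an edge; a single long edge is enough
    here.\<close>
  obtain C where C: "C \<subseteq> S d" "\<not> colorable E C 1"
    "\<And>a b. \<lbrakk>a \<in> C; b \<in> C; E a b; g a < g b\<rbrakk> \<Longrightarrow> \<not> colorable E {y \<in> S d. g a < g y \<and> g y < g b} (2 * c + n)"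
    using ex_long_edges[OF finite_subset_V[OF SV] inj_on_ground[OF SV] adj_irrefl nc] by blast
  obtain a' b' where "a' \<in> C" "b' \<in> C" "E a' b'" using C(2) unfolding colorable_1_iff by blast
  moreover have "g a' \<noteq> g b'" using inj_ground[of a' b'] calculation C(1) SV adj_irrefl[of f r a'] by blast
  ultimately obtain a b where ab: "a \<in> C" "b \<in> C" "E a b" "g a < g b"
    using adj_sym[of f r a' b'] by (cases "g a' < g b'") force+
  have abS: "a \<in> S d" "b \<in> S d" "a \<in> V" "b \<in> V" using ab C(1) SV by blast+
  let ?Z = "{y \<in> S d. g a < g y \<and> g y < g b}"
  define Y where "Y = {y \<in> ?Z. \<not> E y a \<and> \<not> E y b}"
  have trap: "trapped a b y" if "y \<in> Y" for y
    using that SV unfolding Y_def trapped_def by blast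
  have ncY: "\<not> colorable E Y n"
  proof
    assume "colorable E Y n"
    moreover have "colorable E {y \<in> ?Z. E y a} c"
      by (rule colorable_dominated[of _ a]) (use SV abS in blast)+
    moreover have "colorable E {y \<in> ?Z. E y b} c"
      by (rule colorable_dominated[of _ b]) (use SV abS in blast)+
    ultimately have "colorable E (Y \<union> ({y \<in> ?Z. E y a} \<union> {y \<in> ?Z. E y b})) (n + (c + c))"
      by (intro colorable_Un)
    then have "colorable E ?Z (2 * c + n)"
      by (rule colorable_mono) (auto simp: Y_def)
    then show False using C(3)[OF ab] by blast
  qed
  have d: "d \<noteq> 0"
  proof
    assume "d = 0"
    then have "a = b" using abS(1,2) S(1) by simp
    then show False using ab(3) adj_irrefl[of f r b] by simp
  qed
  then obtain e where e: "d = Suc e" by (cases d) auto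
  \<comment> \<open>A trapped flag in an earlier layer would have a trapped predecessor, since
    layers before \<open>d - 1\<close> have no edges to \<open>a\<close> and \<open>b\<close> in
    layer \<open>d\<close>. This descends to \<open>\<rho>\<close>, which does not start above
    \<open>a\<close>.\<close>
  have no_inner: "False" if "z \<in> S i" "i < d" "trapped a b z" for i z
    using that
  proof (induction i arbitrary: z)
    case 0
    then have "z = \<rho>" using S(1) by blast
    then show False using S(3)[OF abS(1)] 0(3) unfolding trapped_def by simp
  next
    case (Suc i)
    obtain z' where z': "z' \<in> S i" "E z z'" using S(4)[OF Suc.prems(1)] by blast
    have "\<not> E z' a" "\<not> E z' b" using S(6)[OF z'(1) abS(1)] S(6)[OF z'(1) abS(2)] Suc.prems(2) by auto
    moreover have "z' \<noteq> a" "z' \<noteq> b" using S(5)[OF z'(1)] abS Suc.prems(2) by (metis Suc_lessD nless_le)+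
    ultimately have "trapped a b z'"
      using trapped_closed[of a b z z'] abS ab Suc.prems(3) z' SV by blast
    then show False using Suc.IH[OF z'(1)] Suc.prems(2) by simp
  qed
  show thesis
  proof (rule that[OF abS(3,4) ab(3) _ trap ncY])
    show "Y \<subseteq> X" using S(2) by (auto simp: Y_def)
    fix y assume y: "y \<in> Y"
    then have "y \<in> S (Suc e)" using e by (auto simp: Y_def)
    then obtain z where z: "z \<in> S e" "E y z" using S(4) by blast
    have "z \<noteq> a" "z \<noteq> b" using S(5)[OF z(1)] abS e by (metis n_not_Suc_n)+
    moreover have "E z a \<or> E z b"
    proof (rule ccontr)
      assume "\<not> ?thesis"
      then have "trapped a b z"
        using trapped_closed[of a b y z] abS ab trap[OF y] z SV \<open>z \<noteq> a\<close> \<open>z \<noteq> b\<close> by blast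
      then show False using no_inner[OF z(1)] e by simp
    qed
    ultimately show "\<exists>z\<in>X. E y z \<and> (E z a \<or> E z b) \<and> z \<noteq> a \<and> z \<noteq> b" using z S(2) by blast
  qed
qed

text \<open>The predecessors \<open>p y\<close> all lie in the neighborhoods of \<open>a\<close> and
  \<open>b\<close>, so \<open>2 * c\<close> colors make them independent. Fixing the color and the
  starting position of \<open>p y\<close> keeps a large class \<open>Z\<close>, dominated by its
  predecessors.\<close>

lemma ex_dominating:
  assumes "X \<subseteq> V" "\<not> colorable E X (layer_bound c m)"
  obtains t Y W where "t < 4" "Y \<subseteq> X" "W \<subseteq> X" "dominates t f r Y W" "\<not> colorable E Y m"
proof -
  interpret mir: flag_step V "mirror f" r k c by (rule mirror_flag_step)
  obtain a b Y where ab: "a \<in> V" "b \<in> V" "E a b" "Y \<subseteq> X" "\<And>y. y \<in> Y \<Longrightarrow> trapped a b y"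
    "\<not> colorable E Y (8 * c * m)"
    "\<And>y. y \<in> Y \<Longrightarrow> \<exists>z\<in>X. E y z \<and> (E z a \<or> E z b) \<and> z \<noteq> a \<and> z \<noteq> b"
    using ex_trapping_pair[OF assms(1), of "8 * c * m"] assms(2) unfolding layer_bound_def by blast
  obtain p where p: "\<And>y. y \<in> Y \<Longrightarrow> p y \<in> X" "\<And>y. y \<in> Y \<Longrightarrow> E y (p y)"
    "\<And>y. y \<in> Y \<Longrightarrow> E (p y) a \<or> E (p y) b" "\<And>y. y \<in> Y \<Longrightarrow> p y \<noteq> a" "\<And>y. y \<in> Y \<Longrightarrow> p y \<noteq> b"
    using ab(7) by metis
  have pV: "p y \<in> V" if "y \<in> Y" for y using p(1)[OF that] assms(1) by blast
  have YV: "Y \<subseteq> V" using ab(4) assms(1) by blast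
  have "colorable E ({z \<in> V. E z a} \<union> {z \<in> V. E z b}) (c + c)"
    by (intro colorable_Un colorable_dominated[of _ a] colorable_dominated[of _ b]) (use ab in blast)+
  then obtain h where h: "\<And>z. z \<in> {z \<in> V. E z a} \<union> {z \<in> V. E z b} \<Longrightarrow> h z < c + c"
    "\<And>z z'. \<lbrakk>z \<in> {z \<in> V. E z a} \<union> {z \<in> V. E z b}; z' \<in> {z \<in> V. E z a} \<union> {z \<in> V. E z b}; E z z'\<rbrakk> \<Longrightarrow> h z \<noteq> h z'"
    unfolding colorable_def by blast
  have pab: "p y \<in> {z \<in> V. E z a} \<union> {z \<in> V. E z b}" if "y \<in> Y" for y
    using p(3)[OF that] pV[OF that] by blast
  \<comment> \<open>The values are the tags of \<open>dominates\<close>: start below the trap,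
    inside above \<open>y\<close>, above the trap, inside below \<open>y\<close>.\<close>
  define side :: "'a \<Rightarrow> nat" where
    "side y = (if g (p y) < g a then 0 else if g b < g (p y) then 2 else if g y < g (p y) then 1 else 3)" for y
  have "side y < 4" for y by (simp add: side_def)
  moreover have "8 * c * m = 4 * (2 * c * m)" by simp
  ultimately obtain t where t: "t < 4" "\<not> colorable E {y \<in> Y. side y = t} (2 * c * m)"
    using ex_class_not_colorable[of E Y 4 "2 * c * m" side] ab(6) by metis
  have "h (p y) < 2 * c" if "y \<in> {y \<in> Y. side y = t}" for y
    using h(1)[OF pab, of y] that by simp
  from ex_class_not_colorable[where h = "\<lambda>y. h (p y)", OF t(2) this]
  obtain q where q: "\<not> colorable E {y \<in> {y \<in> Y. side y = t}. h (p y) = q} m" by blast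
  define Z where "Z = {y \<in> {y \<in> Y. side y = t}. h (p y) = q}"
  have Z: "Z \<subseteq> Y" "\<And>y. y \<in> Z \<Longrightarrow> side y = t" "\<And>y. y \<in> Z \<Longrightarrow> h (p y) = q" by (auto simp: Z_def)
  have indep: "\<not> E w w'" if w: "w \<in> p ` Z" "w' \<in> p ` Z" for w w'
  proof
    assume "E w w'"
    moreover obtain y y' where "w = p y" "w' = p y'" "y \<in> Z" "y' \<in> Z" using w by blast
    ultimately show False using h(2)[OF pab pab, of y y'] Z by auto
  qed
  have pZ: "p ` Z \<subseteq> V" "p ` Z \<subseteq> X" using pV p(1) Z(1) by blast+
  have trap: "trapped a b y" if "y \<in> Z" for y using ab(5) Z(1) that by blast
  have range: "g a < g y" "g y < g b" if "y \<in> Z" for y using trap[OF that] unfolding trapped_def by blast+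
  have neq: "g (p y) \<noteq> g a" "g (p y) \<noteq> g b" "g (p y) \<noteq> g y" if "y \<in> Z" for y
  proof -
    have y: "y \<in> Y" "y \<in> V" using that Z(1) YV by blast+
    have "p y \<noteq> y" using p(2)[OF y(1)] adj_irrefl[of f r y] by metis
    then show "g (p y) \<noteq> g a" "g (p y) \<noteq> g b" "g (p y) \<noteq> g y"
      using inj_ground[OF pV[OF y(1)]] ab(1,2) y p(4,5)[OF y(1)] by metis+
  qed
  consider "t = 0" | "t = 1" | "t = 2" | "t = 3" using t(1) by linarith
  then have "dominates t f r Z (p ` Z)"
  proof cases
    case 1
    have lt: "g (p y) < g y'" if "y \<in> Z" "y' \<in> Z" for y y'
      using Z(2)[OF that(1)] range[OF that(2)] 1 unfolding side_def by (auto split: if_splits)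
    have "needle f r Z (p ` Z)"
      unfolding needle_def using indep lt p(2) Z(1) by blast
    then show ?thesis using 1 by (simp add: dominates_def)
  next
    case 2
    have side: "g a < g (p y)" "g (p y) < g b" "g y < g (p y)" if "y \<in> Z" for y
    proof -
      have "side y = 1" using Z(2)[OF that] 2 by simp
      then have "\<not> g (p y) < g a" "\<not> g b < g (p y)" "g y < g (p y)"
        unfolding side_def by (simp_all split: if_splits)
      then show "g a < g (p y)" "g (p y) < g b" "g y < g (p y)" using neq[OF that] by linarith+
    qed
    have "wall f r Z (p ` Z)"
    proof (rule wall_of_trapped[OF ab(1-3) trap pZ(1) _ indep])
      show "g a < g w \<and> g w < g b \<and> (E w a \<or> E w b)" if "w \<in> p ` Z" for w
        using that side p(3) Z(1) by blast
      show "\<exists>w\<in>p ` Z. g x < g w \<and> E x w" if "x \<in> Z" for x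
        using that side p(2) Z(1) by blast
    qed
    then show ?thesis using 2 by (simp add: dominates_def)
  next
    case 3
    have lt: "g y' < g (p y)" if "y \<in> Z" "y' \<in> Z" for y y'
      using Z(2)[OF that(1)] range[OF that(2)] 3 unfolding side_def by (auto split: if_splits)
    have "needle (mirror f) r Z (p ` Z)"
      unfolding needle_def adj_mirror neg_less_iff_less using indep lt p(2) Z(1) by blast
    then show ?thesis using 3 by (simp add: dominates_def)
  next
    case 4
    have side: "g a < g (p y)" "g (p y) < g b" "g (p y) < g y" if "y \<in> Z" for y
    proof -
      have "side y = 3" using Z(2)[OF that] 4 by simp
      then have "\<not> g (p y) < g a" "\<not> g b < g (p y)" "\<not> g y < g (p y)"
        unfolding side_def by (simp_all split: if_splits)
      then show "g a < g (p y)" "g (p y) < g b" "g (p y) < g y" using neq[OF that] by linarith+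
    qed
    have "wall (mirror f) r Z (p ` Z)"
    proof (rule mir.wall_of_trapped[OF ab(2,1)])
      show "mir.E b a" using ab(3) adj_sym[of f r a b] unfolding adj_mirror by simp
      show "mir.trapped b a x" if "x \<in> Z" for x
        using trap[OF that] unfolding mir.trapped_def trapped_def adj_mirror by simp
      show "- g b < - g w \<and> - g w < - g a \<and> (mir.E w b \<or> mir.E w a)" if "w \<in> p ` Z" for w
        unfolding adj_mirror neg_less_iff_less using that side p(3) Z(1) by blast
      show "\<not> mir.E w w'" if "w \<in> p ` Z" "w' \<in> p ` Z" for w w'
        unfolding adj_mirror using indep that by blast
      show "\<exists>w\<in>p ` Z. - g x < - g w \<and> mir.E x w" if "x \<in> Z" for x
        unfolding adj_mirror neg_less_iff_less using that side p(2) Z(1) by blast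
    qed (rule pZ)
    then show ?thesis using 4 by (simp add: dominates_def)
  qed
  then show thesis
    using that[of t Z "p ` Z"] t(1) Z(1) ab(4) pZ(2) q unfolding Z_def[symmetric] by blast
qed

text \<open>\<open>Ws i\<close> is taken from \<open>Xs i\<close> but dominates
  \<open>Xs (Suc i)\<close>. All later systems therefore consist of flags that \<open>Ws i\<close>
  dominates, which is what makes the systems nested.\<close>

lemma ex_dominating_chain:
  assumes "\<not> colorable E V ((layer_bound c ^^ n) m)"
  shows "\<exists>Xs Ws ts. Xs 0 \<subseteq> V \<and> \<not> colorable E (Xs n) m \<and> (\<forall>i<n. (ts i :: nat) < 4 \<and> Ws i \<subseteq> Xs i \<and>
    Xs (Suc i) \<subseteq> Xs i \<and> dominates (ts i) f r (Xs (Suc i)) (Ws i))"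
  using assms
proof (induction n arbitrary: m)
  case 0
  then show ?case by (intro exI[of _ "\<lambda>_. V"]) auto
next
  case (Suc n)
  have "\<not> colorable E V ((layer_bound c ^^ n) (layer_bound c m))"
    using Suc.prems by (simp add: funpow_swap1)
  from Suc.IH[OF this] obtain Xs Ws ts where s: "Xs 0 \<subseteq> V" "\<not> colorable E (Xs n) (layer_bound c m)"
    "\<And>i. i < n \<Longrightarrow> (ts i :: nat) < 4 \<and> Ws i \<subseteq> Xs i \<and> Xs (Suc i) \<subseteq> Xs i \<and>
      dominates (ts i) f r (Xs (Suc i)) (Ws i)"
    by blast
  have "Xs i \<subseteq> V" if "i \<le> n" for i
    using that
  proof (induction i)
    case (Suc i)
    then show ?case using s(3)[of i] by auto
  qed (rule s(1))
  then have "Xs n \<subseteq> V" by simp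
  from ex_dominating[OF this s(2)] obtain t Y W where t: "t < 4" "Y \<subseteq> Xs n" "W \<subseteq> Xs n"
    "dominates t f r Y W" "\<not> colorable E Y m" by blast
  let ?X = "Xs(Suc n := Y)" and ?W = "Ws(n := W)" and ?t = "ts(n := t)"
  have "?t i < 4 \<and> ?W i \<subseteq> ?X i \<and> ?X (Suc i) \<subseteq> ?X i \<and> dominates (?t i) f r (?X (Suc i)) (?W i)"
    if "i < Suc n" for i
  proof (cases "i = n")
    case False
    then have "i < n" using that by simp
    then show ?thesis using s(3)[of i] by simp
  qed (use t in simp)
  moreover have "?X 0 \<subseteq> V" "\<not> colorable E (?X (Suc n)) m" using s(1) t(5) by simp_all
  ultimately show ?case by blast
qed

text \<open>For needles the nesting sorts the systems: \<open>W2\<close> lies in \<open>X1\<close>,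
  above all of \<open>W1\<close>, and \<open>W3\<close> lies in \<open>X2\<close>, above all of
  \<open>W2\<close>. The reflected cases are instances for \<open>mirror f\<close>.\<close>

lemma colorable_thrice_dominated:
  assumes V: "X1 \<subseteq> V" "W1 \<subseteq> V" and sub: "X2 \<subseteq> X1" "X3 \<subseteq> X2" "W2 \<subseteq> X1" "W3 \<subseteq> X2"
  shows "wall f r X1 W1 \<Longrightarrow> wall f r X2 W2 \<Longrightarrow> colorable E X2 (2 * (3 * c + 1) * c)"
    "needle f r X1 W1 \<Longrightarrow> needle f r X2 W2 \<Longrightarrow> needle f r X3 W3 \<Longrightarrow> colorable E X3 (2 * (c * c + k * c + 1) * c)"
proof -
  show "colorable E X2 (2 * (3 * c + 1) * c)" if "wall f r X1 W1" "wall f r X2 W2"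
    using colorable_nested_walls[OF V sub(1,3) that] .
  assume n: "needle f r X1 W1" "needle f r X2 W2" "needle f r X3 W3"
  show "colorable E X3 (2 * (c * c + k * c + 1) * c)"
  proof (rule colorable_nested_needles)
    show "needle f r X3 W1" "needle f r X3 W2" "needle f r X3 W3"
      using n sub needle_subset by blast+
    show "g a < g b" if "a \<in> W1" "b \<in> W2" for a b using needleD(2)[OF n(1)] that sub by blast
    show "g a < g b" if "a \<in> W2" "b \<in> W3" for a b using needleD(2)[OF n(2)] that sub by blast
  qed (use V sub in blast)+
qed

theorem colorable_flags: "colorable E V (flag_bound k c)"
proof (rule ccontr)
  let ?M = "2 * (3 * c + 1) * c + 2 * (c * c + k * c + 1) * c"
  interpret mir: flag_step V "mirror f" r k c by (rule mirror_flag_step)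
  assume "\<not> ?thesis"
  then obtain Xs Ws ts where s: "Xs 0 \<subseteq> V" "\<not> colorable E (Xs 9) ?M"
    "\<And>i. i < 9 \<Longrightarrow> (ts i :: nat) < 4 \<and> Ws i \<subseteq> Xs i \<and> Xs (Suc i) \<subseteq> Xs i \<and>
      dominates (ts i) f r (Xs (Suc i)) (Ws i)"
    using ex_dominating_chain[of 9 ?M] unfolding flag_bound_def by blast
  have anti: "Xs j \<subseteq> Xs i" if "i \<le> j" "j \<le> 9" for i j
    using that
  proof (induction j rule: dec_induct)
    case (step j)
    then show ?case using s(3)[of j] by auto
  qed simp
  have "ts \<in> {..<9} \<rightarrow> {..<4}" using s(3) by blast
  moreover have "{..<4 :: nat} \<noteq> {}" by (simp add: lessThan_empty_iff)
  ultimately obtain t where "card {..<9 :: nat} \<le> card (ts -` {t} \<inter> {..<9}) * card {..<4 :: nat}"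
    using pigeonhole_card[of ts "{..<9}" "{..<4}"] by blast
  then have t: "9 \<le> card (ts -` {t} \<inter> {..<9}) * 4" by simp
  obtain P where P: "P \<subseteq> ts -` {t} \<inter> {..<9}" "card P = 3"
  proof (rule obtain_subset_with_card_n)
    show "3 \<le> card (ts -` {t} \<inter> {..<9})" using t by linarith
  qed
  have "finite P" using P(2) by (simp add: card_ge_0_finite)
  then have l: "length (sorted_list_of_set P) = 3" "set (sorted_list_of_set P) = P"
    "sorted_wrt (<) (sorted_list_of_set P)" using P(2) by simp_all
  have "\<exists>x y z. xs = [x, y, z]" if "length xs = 3" for xs :: "nat list"
    using that by (auto simp: length_Suc_conv numeral_3_eq_3)
  from this[OF l(1)] obtain i1 i2 i3 where "sorted_list_of_set P = [i1, i2, i3]" by blast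
  then have i: "i1 < i2" "i2 < i3" "{i1, i2, i3} = P" using l by auto
  then have i9: "i3 < 9" "i2 < 9" "i1 < 9" and ts: "ts i1 = t" "ts i2 = t" "ts i3 = t" using P(1) by auto
  let ?X1 = "Xs (Suc i1)" and ?X2 = "Xs (Suc i2)" and ?X3 = "Xs (Suc i3)"
  have XV: "Xs j \<subseteq> V" if "j \<le> 9" for j using anti[OF _ that, of 0] s(1) by blast
  have V: "?X1 \<subseteq> V" "Ws i1 \<subseteq> V"
    using XV[of "Suc i1"] XV[of i1] s(3)[OF i9(3)] i9(3) by auto
  have W: "Ws i2 \<subseteq> Xs i2" "Ws i3 \<subseteq> Xs i3" using s(3) i9 by blast+
  have sub: "?X2 \<subseteq> ?X1" "?X3 \<subseteq> ?X2" "Ws i2 \<subseteq> ?X1" "Ws i3 \<subseteq> ?X2"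
  proof -
    show "?X2 \<subseteq> ?X1" "?X3 \<subseteq> ?X2" by (rule anti; use i i9 in simp)+
    have "Xs i2 \<subseteq> ?X1" "Xs i3 \<subseteq> ?X2" by (rule anti; use i i9 in simp)+
    then show "Ws i2 \<subseteq> ?X1" "Ws i3 \<subseteq> ?X2" using W by blast+
  qed
  have X9: "Xs 9 \<subseteq> ?X2" "Xs 9 \<subseteq> ?X3" by (rule anti; use i9 in simp)+
  have dom: "dominates t f r ?X1 (Ws i1)" "dominates t f r ?X2 (Ws i2)" "dominates t f r ?X3 (Ws i3)"
    using s(3)[OF i9(1)] s(3)[OF i9(2)] s(3)[OF i9(3)] ts by simp_all
  have "colorable E ?X2 (2 * (3 * c + 1) * c) \<or> colorable E ?X3 (2 * (c * c + k * c + 1) * c)"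
  proof -
    consider "t = 0" | "t = 1" | "t = 2" | "t \<noteq> 0" "t \<noteq> 1" "t \<noteq> 2" by blast
    then show ?thesis
    proof cases
      case 1
      then show ?thesis using dom colorable_thrice_dominated(2)[OF V sub] by (simp add: dominates_def)
    next
      case 2
      then show ?thesis using dom colorable_thrice_dominated(1)[OF V sub] by (simp add: dominates_def)
    next
      case 3
      then show ?thesis
        using dom mir.colorable_thrice_dominated(2)[OF V sub] unfolding adj_mirror by (simp add: dominates_def)
    next
      case 4
      then show ?thesis
        using dom mir.colorable_thrice_dominated(1)[OF V sub] unfolding adj_mirror by (simp add: dominates_def)
    qed
  qed
  then have "colorable E (Xs 9) ?M"
  proof
    assume "colorable E ?X2 (2 * (3 * c + 1) * c)"
    then show ?thesis by (rule colorable_mono) (use X9 in auto)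
  next
    assume "colorable E ?X3 (2 * (c * c + k * c + 1) * c)"
    then show ?thesis by (rule colorable_mono) (use X9 in auto)
  qed
  then show False using s(2) by blast
qed

end

theorem flags_chi_bounded:
  "\<exists>c. \<forall>(V :: 'a set) f r. flags V f r \<longrightarrow> (\<forall>K\<subseteq>V. pairwise_adjacent (adj f r) K \<longrightarrow> card K \<le> k) \<longrightarrow>
    colorable (adj f r) V c"
proof (induction k)
  case 0
  have "colorable (adj f r) V 0"
    if "flags V f r" "\<forall>K\<subseteq>V. pairwise_adjacent (adj f r) K \<longrightarrow> card K \<le> 0" for V :: "'a set" and f r
  proof -
    have "V = {}"
    proof (rule ccontr)
      assume "V \<noteq> {}"
      then obtain x where "x \<in> V" by blast
      then have "card {x} \<le> 0" using that(2) by (auto simp: pairwise_adjacent_def simp del: card_insert_disjoint)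
      then show False by simp
    qed
    then show ?thesis by simp
  qed
  then show ?case by blast
next
  case (Suc k)
  then obtain c where c: "\<And>(V :: 'a set) f r. \<lbrakk>flags V f r;
    \<forall>K\<subseteq>V. pairwise_adjacent (adj f r) K \<longrightarrow> card K \<le> k\<rbrakk> \<Longrightarrow> colorable (adj f r) V c" by blast
  \<comment> \<open>The step lemma needs cliques of size at least 2 to be allowed; for clique bound
    1 there are no edges and one color suffices.\<close>
  have "colorable (adj f r) V (max 1 (flag_bound (Suc k) c))"
    if fl: "flags V f r" and cl: "\<forall>K\<subseteq>V. pairwise_adjacent (adj f r) K \<longrightarrow> card K \<le> Suc k" for V :: "'a set" and f r
  proof (cases "k = 0")
    case True
    have "\<not> adj f r x y" if xy: "x \<in> V" "y \<in> V" for x y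
    proof
      assume adj: "adj f r x y"
      then have "x \<noteq> y" by (simp add: adj_def)
      moreover have "pairwise_adjacent (adj f r) {x, y}"
        using adj adj_sym[of f r x y] by (auto simp: pairwise_adjacent_def)
      then have "card {x, y} \<le> Suc k" using cl xy by simp
      ultimately show False using True by simp
    qed
    then have "colorable (adj f r) V 1" unfolding colorable_1_iff by blast
    then show ?thesis by (rule colorable_le) simp
  next
    case False
    interpret flags V f r by (rule fl)
    interpret flag_step V f r "Suc k" c
    proof
      show "2 \<le> Suc k" using False by simp
      show "card K \<le> Suc k" if "K \<subseteq> V" "pairwise_adjacent E K" for K using cl that by blast
      show "colorable (adj f r') A c" if A: "A \<subseteq> V" and r': "\<And>i. i \<in> A \<Longrightarrow> 0 \<le> r' i \<and> r' i \<le> r i"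
        and cA: "\<And>K. \<lbrakk>K \<subseteq> A; pairwise_adjacent (adj f r') K\<rbrakk> \<Longrightarrow> card K < Suc k" for A r'
      proof (rule c)
        have le: "x \<le> r i" "i \<in> V" "0 \<le> r' i" if "i \<in> A" "x \<le> r' i" for i x using r'[of i] that A by auto
        show "flags A f r'"
        proof
          show "finite A" using A finite_V finite_subset by blast
          show "0 \<le> r' i" if "i \<in> A" for i using r' that by blast
          show "i = j" if "i \<in> A" "j \<in> A" "f i 0 = f j 0" for i j using that A inj_ground by blast
          show "f i x < f j x" if "i \<in> A" "j \<in> A" "f i 0 < f j 0" "0 \<le> x" "x \<le> r' i" "x \<le> r' j"
            "\<And>t. \<lbrakk>0 \<le> t; t \<le> x\<rbrakk> \<Longrightarrow> f i t \<noteq> f j t" for i j x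
            by (rule order_kept[OF _ _ that(3,4) _ _ that(7)]) (use le that in blast)+
          show "f j x < f i x" if "i \<in> A" "j \<in> A" "f i 0 < f j 0" "0 \<le> t" "t < x" "x \<le> r' i" "x \<le> r' j"
            "f i t = f j t" for i j t x
            by (rule order_swapped[OF _ _ that(3-5) _ _ that(8)]) (use le that in blast)+
        qed
        show "\<forall>K\<subseteq>A. pairwise_adjacent (adj f r') K \<longrightarrow> card K \<le> k" using cA by (auto simp: less_Suc_eq_le)
      qed
    qed
    show ?thesis using colorable_flags by (rule colorable_le) simp
  qed
  then show ?case by blast
qed

section \<open>Curves meeting a vertical line\<close>

lemma less_preserved_without_meeting:
  fixes p q :: "real \<Rightarrow> real"
  assumes "continuous_on {a..b} p" "continuous_on {a..b} q" "a \<le> b" "p a < q a"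
    and "\<And>t. \<lbrakk>a \<le> t; t \<le> b\<rbrakk> \<Longrightarrow> p t \<noteq> q t"
  shows "p b < q b"
proof (rule ccontr)
  assume "\<not> p b < q b"
  moreover have "continuous_on {a..b} (\<lambda>x. p x - q x)" using assms by (intro continuous_intros)
  ultimately have "\<exists>x\<ge>a. x \<le> b \<and> p x - q x = 0"
    using IVT'[of "\<lambda>x. p x - q x" a 0 b] assms by simp
  then show False using assms(5) by auto
qed

text \<open>The initial order persists up to the meeting point, which rules out the second
  alternative of \<open>cross\<close>. The first one gives the swapped order just after it, and by
  uniqueness of the meeting point the intermediate value theorem carries that order on.\<close>

lemma flagsI:
  assumes "finite V" "\<And>i. i \<in> V \<Longrightarrow> 0 \<le> r i" "\<And>i. i \<in> V \<Longrightarrow> continuous_on {0..r i} (f i)"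
    and inj: "\<And>i j. \<lbrakk>i \<in> V; j \<in> V; f i 0 = f j 0\<rbrakk> \<Longrightarrow> i = j"
    and once: "\<And>i j t t'. \<lbrakk>i \<in> V; j \<in> V; i \<noteq> j; 0 \<le> t; t \<le> r i; t \<le> r j; f i t = f j t;
      0 \<le> t'; t' \<le> r i; t' \<le> r j; f i t' = f j t'\<rbrakk> \<Longrightarrow> t = t'"
    and cross: "\<And>i j t. \<lbrakk>i \<in> V; j \<in> V; i \<noteq> j; 0 < t; t < r i; t < r j; f i t = f j t\<rbrakk> \<Longrightarrow>
      \<exists>e>0. (\<forall>x. 0 \<le> x \<and> t - e < x \<and> x < t \<longrightarrow> f i x < f j x) \<and>
          (\<forall>x. t < x \<and> x < t + e \<and> x \<le> r i \<and> x \<le> r j \<longrightarrow> f j x < f i x) \<or>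
        (\<forall>x. 0 \<le> x \<and> t - e < x \<and> x < t \<longrightarrow> f j x < f i x)"
  shows "flags V f r"
proof
  show "finite V" "\<And>i. i \<in> V \<Longrightarrow> 0 \<le> r i" "\<And>i j. \<lbrakk>i \<in> V; j \<in> V; f i 0 = f j 0\<rbrakk> \<Longrightarrow> i = j"
    using assms by blast+
  have cont: "continuous_on {a..b} (f i)" if "i \<in> V" "0 \<le> a" "b \<le> r i" for i a b
    using assms(3)[OF that(1)] by (rule continuous_on_subset) (use that in auto)
  show kept: "f i x < f j x" if "i \<in> V" "j \<in> V" "f i 0 < f j 0" "0 \<le> x" "x \<le> r i" "x \<le> r j"
    "\<And>t. \<lbrakk>0 \<le> t; t \<le> x\<rbrakk> \<Longrightarrow> f i t \<noteq> f j t" for i j x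
    using less_preserved_without_meeting[of 0 x "f i" "f j"] cont that by simp
  show "f j x < f i x" if ij: "i \<in> V" "j \<in> V" "f i 0 < f j 0" and t: "0 \<le> t" "t < x" "x \<le> r i" "x \<le> r j"
    "f i t = f j t" for i j t x
  proof -
    have "i \<noteq> j" using ij by auto
    have once': "t' = t" if "0 \<le> t'" "t' \<le> r i" "t' \<le> r j" "f i t' = f j t'" for t'
      using once[OF ij(1,2) \<open>i \<noteq> j\<close> that, of t] t by simp
    have "t \<noteq> 0" using ij(3) t(5) by auto
    then have "0 < t" using t(1) by simp
    then obtain e where e: "e > 0" "(\<forall>x. 0 \<le> x \<and> t - e < x \<and> x < t \<longrightarrow> f i x < f j x) \<and>
          (\<forall>x. t < x \<and> x < t + e \<and> x \<le> r i \<and> x \<le> r j \<longrightarrow> f j x < f i x) \<or>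
        (\<forall>x. 0 \<le> x \<and> t - e < x \<and> x < t \<longrightarrow> f j x < f i x)"
      using cross[OF ij(1,2) \<open>i \<noteq> j\<close>, of t] t by auto
    \<comment> \<open>\<open>t / 2\<close> keeps \<open>y\<close> on the nonnegative side,
      \<open>t - e / 2\<close> keeps it in the window of the crossing condition.\<close>
    define y where "y = max (t / 2) (t - e / 2)"
    have y: "0 \<le> y" "t - e < y" "y < t" "y \<le> r i" "y \<le> r j" using \<open>0 < t\<close> e(1) t unfolding y_def by auto
    have "f i y < f j y"
    proof (rule kept[OF ij y(1,4,5)])
      show "f i t' \<noteq> f j t'" if "0 \<le> t'" "t' \<le> y" for t' using once'[of t'] that y by auto
    qed
    then have right: "\<And>x. \<lbrakk>t < x; x < t + e; x \<le> r i; x \<le> r j\<rbrakk> \<Longrightarrow> f j x < f i x"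
      using e(2) y by (metis order_less_asym)
    define z where "z = min x (t + e / 2)"
    have z: "t < z" "z < t + e" "z \<le> x" using e(1) t unfolding z_def by auto
    show ?thesis
    proof (rule less_preserved_without_meeting[of z x])
      show "continuous_on {z..x} (f j)" "continuous_on {z..x} (f i)" using cont ij z t by auto
      show "f j z < f i z" using right[of z] z t by simp
      show "f j t' \<noteq> f i t'" if "z \<le> t'" "t' \<le> x" for t'
        using once'[of t'] that z t by auto
    qed (rule z(3))
  qed
qed

text \<open>Along the arc the abscissa \<open>u\<close> is continuous and, by monotonicity,
  injective; on a compact interval its inverse is continuous, which makes the height a continuous
  function of the abscissa.\<close>

lemma x_monotone_curve_graph:
  assumes "x_monotone_curve C"
  shows "\<exists>a b \<phi>. a \<le> b \<and> C = (\<lambda>x. (x, \<phi> x)) ` {a..b} \<and> continuous_on {a..b} \<phi> \<and>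
    (\<forall>x. a < x \<and> x < b \<longrightarrow> (x, \<phi> x) \<in> curve_interior C)"
proof -
  obtain g where g: "arc g" "path_image g = C" using assms by (auto simp: x_monotone_curve_def is_curve_def)
  have cont: "continuous_on {0..1} g" and inj_g: "inj_on g {0..1}" using g(1) by (auto simp: arc_def path_def)
  have C: "C = g ` {0..1}" using g(2) by (auto simp: path_image_def)
  define u where "u t = fst (g t)" for t
  have u: "continuous_on {0..1} u" unfolding u_def by (intro continuous_intros cont)
  have inj_u: "inj_on u {0..1}"
  proof (rule inj_onI)
    fix s t assume st: "s \<in> {0..1}" "t \<in> {0..1}" "u s = u t"
    have "(u s, snd (g s)) = g s" "(u s, snd (g t)) = g t" using st(3) by (simp_all add: u_def prod_eq_iff)
    then have "(u s, snd (g s)) \<in> C" "(u s, snd (g t)) \<in> C" unfolding C using st(1,2) by simp_all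
    then have "snd (g s) = snd (g t)" using assms unfolding x_monotone_curve_def by blast
    then have "g s = g t" using st(3) by (simp add: u_def prod_eq_iff)
    then show "s = t" using inj_g st by (meson inj_onD)
  qed
  obtain a b where ab: "u ` {0..1} = {a..b}"
    using connected_compact_interval_1[of "u ` {0..1}"] u
    by (metis compact_Icc compact_continuous_image connected_Icc connected_continuous_image)
  have "u 0 \<in> {a..b}" unfolding ab[symmetric] by simp
  then have le: "a \<le> b" by simp
  define v where "v = the_inv_into {0..1} u"
  have v: "v x \<in> {0..1}" "u (v x) = x" if "x \<in> {a..b}" for x
    using that the_inv_into_into[OF inj_u _ subset_refl, of x] f_the_inv_into_f[OF inj_u, of x]
    unfolding ab[symmetric] v_def by auto
  have "continuous_on {a..b} v"
    unfolding ab[symmetric] v_def by (rule continuous_on_inv_into[OF u _ inj_u]) simp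
  then have contv: "continuous_on {a..b} (\<lambda>x. g (v x))"
    by (rule continuous_on_compose2[OF cont]) (use v in auto)
  \<comment> \<open>An injective continuous function attains its extremes at the endpoints, so
    abscissas strictly between \<open>a\<close> and \<open>b\<close> belong to interior
    parameters.\<close>
  have ends: "u t = a \<or> u t = b" if "t = 0 \<or> t = 1" for t
  proof -
    have mono: "u 0 < u s \<and> u s < u 1 \<or> u 1 < u s \<and> u s < u 0" if "0 < s" "s < 1" for s
      using continuous_inj_imp_mono[OF that u inj_u] .
    have in_ab: "u 0 \<in> {a..b}" "u 1 \<in> {a..b}" unfolding ab[symmetric] by auto
    have "a \<in> u ` {0..1}" "b \<in> u ` {0..1}" unfolding ab using le by auto
    then obtain s s' where s: "s \<in> {0..1}" "u s = a" "s' \<in> {0..1}" "u s' = b" by blast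
    have "s = 0 \<or> s = 1" using mono[of s] s in_ab by (cases "s = 0"; cases "s = 1") auto
    moreover have "s' = 0 \<or> s' = 1" using mono[of s'] s in_ab by (cases "s' = 0"; cases "s' = 1") auto
    moreover have "s \<noteq> s'"
    proof
      assume "s = s'"
      then have "u 0 = u 1" using s in_ab by auto
      then show False using inj_onD[OF inj_u, of 0 1] by simp
    qed
    ultimately show ?thesis using that s by auto
  qed
  have "C = (\<lambda>x. (x, snd (g (v x)))) ` {a..b}"
  proof
    show "C \<subseteq> (\<lambda>x. (x, snd (g (v x)))) ` {a..b}"
    proof
      fix p assume "p \<in> C"
      then obtain t where t: "t \<in> {0..1}" "p = g t" unfolding C by blast
      then have ut: "u t \<in> {a..b}" unfolding ab[symmetric] by blast
      have "v (u t) = t" unfolding v_def by (rule the_inv_into_f_f[OF inj_u t(1)])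
      then have "p = (u t, snd (g (v (u t))))" using t by (simp add: u_def)
      then show "p \<in> (\<lambda>x. (x, snd (g (v x)))) ` {a..b}" using ut by (rule image_eqI)
    qed
    show "(\<lambda>x. (x, snd (g (v x)))) ` {a..b} \<subseteq> C"
    proof clarify
      fix x assume x: "x \<in> {a..b}"
      have "(x, snd (g (v x))) = g (v x)" using v(2)[OF x] by (simp add: u_def prod_eq_iff)
      then show "(x, snd (g (v x))) \<in> C" unfolding C using v(1)[OF x] by simp
    qed
  qed
  moreover have "continuous_on {a..b} (\<lambda>x. snd (g (v x)))" by (intro continuous_intros contv)
  moreover have "(x, snd (g (v x))) \<in> curve_interior C" if x: "a < x" "x < b" for x
  proof -
    have x': "x \<in> {a..b}" using x by simp
    have "v x \<noteq> 0" "v x \<noteq> 1" using ends[of "v x"] v(2)[OF x'] x by auto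
    then have "v x \<in> {0<..<1}" using v(1)[OF x'] by auto
    moreover have "(x, snd (g (v x))) = g (v x)" using v(2)[OF x'] by (simp add: u_def prod_eq_iff)
    ultimately show ?thesis unfolding curve_interior_def using g by (auto intro!: exI[of _ g])
  qed
  ultimately show ?thesis
    using le by (intro exI[of _ a] exI[of _ b] exI[of _ "\<lambda>x. snd (g (v x))"]) simp
qed

definition crosses :: "plane set \<Rightarrow> plane set \<Rightarrow> bool" where
  "crosses C D \<longleftrightarrow> C \<noteq> D \<and> C \<inter> D \<noteq> {}"

lemma colorable_card:
  assumes "finite A" "\<And>x. \<not> E x x"
  shows "colorable E A (card A)"
proof -
  obtain h where h: "bij_betw h A {0..<card A}" using ex_bij_betw_finite_nat[OF assms(1)] by blast
  show ?thesis
  proof (rule colorableI)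
    show "h x < card A" if "x \<in> A" for x using h that by (auto simp: bij_betw_def)
    show "h x \<noteq> h y" if "x \<in> A" "y \<in> A" "E x y" for x y
      using h that assms(2) by (metis bij_betw_def inj_on_eq_iff)
  qed
qed


text \<open>Curves through one point of the line form a clique, so \<open>k\<close> colors make the
  heights on the line distinct, as \<open>inj_ground\<close> demands. The flags to the right and to
  the left cost \<open>c0\<close> colors each, and every crossing lies on one of the two
  sides.\<close>

lemma colorable_through_common_line:
  fixes c0 :: nat
  assumes c0: "\<And>(V :: plane set set) f r. \<lbrakk>flags V f r;
      \<forall>K\<subseteq>V. pairwise_adjacent (adj f r) K \<longrightarrow> card K \<le> k\<rbrakk> \<Longrightarrow> colorable (adj f r) V c0"
    and F: "finite F" "\<And>C. C \<in> F \<Longrightarrow> x_monotone_curve C" "simple_family F"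
    and cl: "\<And>K. \<lbrakk>K \<subseteq> F; pairwise_adjacent crosses K\<rbrakk> \<Longrightarrow> card K \<le> k"
    and line: "\<And>C. C \<in> F \<Longrightarrow> \<exists>y. (s, y) \<in> C"
  shows "colorable crosses F (k * (c0 * c0))"
proof -
  define P :: "plane set \<Rightarrow> real \<times> real \<times> (real \<Rightarrow> real) \<Rightarrow> bool" where
    "P C T \<longleftrightarrow> (case T of (a, b, \<phi>) \<Rightarrow> C = (\<lambda>x. (x, \<phi> x)) ` {a..b} \<and> continuous_on {a..b} \<phi> \<and>
      (\<forall>x. a < x \<and> x < b \<longrightarrow> (x, \<phi> x) \<in> curve_interior C))" for C T
  have "\<forall>C\<in>F. \<exists>T. P C T"
  proof
    fix C assume "C \<in> F"
    from x_monotone_curve_graph[OF F(2)[OF this]] obtain a b \<phi> where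
      "C = (\<lambda>x. (x, \<phi> x)) ` {a..b} \<and> continuous_on {a..b} \<phi> \<and>
        (\<forall>x. a < x \<and> x < b \<longrightarrow> (x, \<phi> x) \<in> curve_interior C)"
      by (elim exE conjE) simp
    then have "P C (a, b, \<phi>)" unfolding P_def case_prod_conv .
    then show "\<exists>T. P C T" ..
  qed
  from bchoice[OF this] obtain T where T: "\<forall>C\<in>F. P C (T C)" ..
  define A B \<Phi> where "A C = fst (T C)" and "B C = fst (snd (T C))" and "\<Phi> C = snd (snd (T C))" for C
  have gr: "C = (\<lambda>x. (x, \<Phi> C x)) ` {A C..B C}" "continuous_on {A C..B C} (\<Phi> C)"
    "\<And>x. \<lbrakk>A C < x; x < B C\<rbrakk> \<Longrightarrow> (x, \<Phi> C x) \<in> curve_interior C" if "C \<in> F" for C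
    using bspec[OF T that] unfolding P_def A_def B_def \<Phi>_def case_prod_beta by blast+
  have mem: "(x, y) \<in> C \<longleftrightarrow> A C \<le> x \<and> x \<le> B C \<and> y = \<Phi> C x" if "C \<in> F" for C x y
    using arg_cong[OF gr(1)[OF that], of "\<lambda>S. (x, y) \<in> S"] by auto
  have s: "A C \<le> s" "s \<le> B C" if "C \<in> F" for C using line[OF that] mem[OF that] by auto
  have crossesI: "crosses C D" if "C \<in> F" "D \<in> F" "C \<noteq> D" "A C \<le> x" "x \<le> B C" "A D \<le> x" "x \<le> B D" "\<Phi> C x = \<Phi> D x" for C D x
  proof -
    have "(x, \<Phi> C x) \<in> C \<inter> D" using that mem by simp
    then show ?thesis using that(3) unfolding crosses_def by blast
  qed
  have once: "x = x'" if "C \<in> F" "D \<in> F" "C \<noteq> D" "A C \<le> x" "x \<le> B C" "A D \<le> x" "x \<le> B D" "\<Phi> C x = \<Phi> D x"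
    "A C \<le> x'" "x' \<le> B C" "A D \<le> x'" "x' \<le> B D" "\<Phi> C x' = \<Phi> D x'" for C D x x'
  proof -
    have "(x, \<Phi> C x) \<in> C \<inter> D" "(x', \<Phi> C x') \<in> C \<inter> D" using that mem by simp_all
    moreover have "\<forall>p\<in>C \<inter> D. \<forall>q\<in>C \<inter> D. p = q"
      using F(3) that(1-3) unfolding simple_family_def pairwise_def by blast
    ultimately have "(x, \<Phi> C x) = (x', \<Phi> C x')" by blast
    then show ?thesis by simp
  qed
  have below: "below_on X C D \<longleftrightarrow> (\<forall>x\<in>X. A C \<le> x \<and> x \<le> B C \<and> A D \<le> x \<and> x \<le> B D \<longrightarrow> \<Phi> C x < \<Phi> D x)"
    if "C \<in> F" "D \<in> F" for C D X
    unfolding below_on_def using mem that by simp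
  \<comment> \<open>Signed offsets from \<open>p\<close> serve both directions of travel: for the
    left side, before and after change places, and so do the two alternatives.\<close>
  have proper: "\<exists>e>0. (\<forall>x. x - p \<in> {-e<..<0} \<and> x \<in> {A C..B C} \<inter> {A D..B D} \<longrightarrow> \<Phi> C x < \<Phi> D x) \<and>
        (\<forall>x. x - p \<in> {0<..<e} \<and> x \<in> {A C..B C} \<inter> {A D..B D} \<longrightarrow> \<Phi> D x < \<Phi> C x) \<or>
      (\<forall>x. x - p \<in> {-e<..<0} \<and> x \<in> {A C..B C} \<inter> {A D..B D} \<longrightarrow> \<Phi> D x < \<Phi> C x) \<and>
        (\<forall>x. x - p \<in> {0<..<e} \<and> x \<in> {A C..B C} \<inter> {A D..B D} \<longrightarrow> \<Phi> C x < \<Phi> D x)"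
    if "C \<in> F" "D \<in> F" "C \<noteq> D" "A C < p" "p < B C" "A D < p" "p < B D" "\<Phi> C p = \<Phi> D p" for C D p
  proof -
    have "(p, \<Phi> C p) \<in> curve_interior C \<inter> curve_interior D"
      using gr(3)[OF that(1,4,5)] gr(3)[OF that(2,6,7)] that(8) by simp
    then have "cross_properly_at C D (p, \<Phi> C p)"
      using F(3) that(1-3) unfolding simple_family_def pairwise_def by blast
    then obtain e where e: "e > 0" "below_on {p - e<..<p} C D \<and> below_on {p<..<p + e} D C \<or>
        below_on {p - e<..<p} D C \<and> below_on {p<..<p + e} C D"
      unfolding cross_properly_at_def by auto
    then show ?thesis
      unfolding below[OF that(1,2)] below[OF that(2,1)] by (intro exI[of _ e]) force
  qed
  define E0 where "E0 C D \<longleftrightarrow> C \<noteq> D \<and> \<Phi> C s = \<Phi> D s" for C D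
  have "colorable E0 F k"
  proof (rule colorable_fibres[where p = "\<lambda>C. \<Phi> C s"])
    fix y
    let ?A = "{C \<in> F. \<Phi> C s = y}"
    have "pairwise_adjacent crosses ?A"
      unfolding pairwise_adjacent_def using crossesI[of _ _ s] s by auto
    then have "card ?A \<le> k" using cl by auto
    moreover have "colorable E0 ?A (card ?A)" by (rule colorable_card) (use F(1) in \<open>auto simp: E0_def\<close>)
    ultimately show "colorable E0 ?A k" using colorable_le by blast
  qed (simp add: E0_def)
  then show ?thesis
  proof (rule colorable_product)
    fix G assume G: "G \<subseteq> F" and "\<And>C D. \<lbrakk>C \<in> G; D \<in> G\<rbrakk> \<Longrightarrow> \<not> E0 C D"
    then have inj: "C = D" if "C \<in> G" "D \<in> G" "\<Phi> C s = \<Phi> D s" for C D using that by (auto simp: E0_def)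
    \<comment> \<open>\<open>\<sigma>\<close> is the direction in which the flags leave the line,
      and \<open>r\<close> the distance to the endpoint of the curve on that side.\<close>
    have side: "colorable (adj (\<lambda>C t. \<Phi> C (s + \<sigma> * t)) r) G c0"
      if \<sigma>: "\<sigma> = 1 \<or> \<sigma> = -1" and r: "\<And>C. r C = (if \<sigma> = 1 then B C - s else s - A C)" for \<sigma> r
    proof (rule c0)
      have rng: "A C \<le> s + \<sigma> * t" "s + \<sigma> * t \<le> B C" if "C \<in> G" "0 \<le> t" "t \<le> r C" for C t
        using that r[of C] \<sigma> s[of C] G by (auto split: if_splits)
      have rng': "A C < s + \<sigma> * t" "s + \<sigma> * t < B C" if "C \<in> G" "0 < t" "t < r C" for C t
        using that r[of C] \<sigma> s[of C] G by (auto split: if_splits)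
      show "flags G (\<lambda>C t. \<Phi> C (s + \<sigma> * t)) r"
      proof (rule flagsI)
        show "finite G" using F(1) G finite_subset by blast
        show "0 \<le> r C" if "C \<in> G" for C using r[of C] s[of C] G that by auto
        show "continuous_on {0..r C} (\<lambda>t. \<Phi> C (s + \<sigma> * t))" if C: "C \<in> G" for C
          by (rule continuous_on_compose2[OF gr(2)[of C]])
            (use C G rng[OF C] in \<open>auto intro!: continuous_intros\<close>)
        show "C = D" if "C \<in> G" "D \<in> G" "\<Phi> C (s + \<sigma> * 0) = \<Phi> D (s + \<sigma> * 0)" for C D
          using inj that by simp
        show "t = t'" if "C \<in> G" "D \<in> G" "C \<noteq> D" "0 \<le> t" "t \<le> r C" "t \<le> r D" "\<Phi> C (s + \<sigma> * t) = \<Phi> D (s + \<sigma> * t)"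
          "0 \<le> t'" "t' \<le> r C" "t' \<le> r D" "\<Phi> C (s + \<sigma> * t') = \<Phi> D (s + \<sigma> * t')" for C D t t'
        proof -
          have "s + \<sigma> * t = s + \<sigma> * t'" by (rule once[of C D]) (use that rng G in auto)
          then show ?thesis using \<sigma> by auto
        qed
        show "\<exists>e>0. (\<forall>x. 0 \<le> x \<and> t - e < x \<and> x < t \<longrightarrow> \<Phi> C (s + \<sigma> * x) < \<Phi> D (s + \<sigma> * x)) \<and>
            (\<forall>x. t < x \<and> x < t + e \<and> x \<le> r C \<and> x \<le> r D \<longrightarrow> \<Phi> D (s + \<sigma> * x) < \<Phi> C (s + \<sigma> * x)) \<or>
            (\<forall>x. 0 \<le> x \<and> t - e < x \<and> x < t \<longrightarrow> \<Phi> D (s + \<sigma> * x) < \<Phi> C (s + \<sigma> * x))"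
          if CD: "C \<in> G" "D \<in> G" "C \<noteq> D" "0 < t" "t < r C" "t < r D" "\<Phi> C (s + \<sigma> * t) = \<Phi> D (s + \<sigma> * t)" for C D t
        proof -
          have CDF: "C \<in> F" "D \<in> F" using CD(1,2) G by blast+
          obtain e where "e > 0" and e: "(\<forall>x. x - (s + \<sigma> * t) \<in> {-e<..<0} \<and> x \<in> {A C..B C} \<inter> {A D..B D} \<longrightarrow> \<Phi> C x < \<Phi> D x) \<and>
              (\<forall>x. x - (s + \<sigma> * t) \<in> {0<..<e} \<and> x \<in> {A C..B C} \<inter> {A D..B D} \<longrightarrow> \<Phi> D x < \<Phi> C x) \<or>
            (\<forall>x. x - (s + \<sigma> * t) \<in> {-e<..<0} \<and> x \<in> {A C..B C} \<inter> {A D..B D} \<longrightarrow> \<Phi> D x < \<Phi> C x) \<and>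
              (\<forall>x. x - (s + \<sigma> * t) \<in> {0<..<e} \<and> x \<in> {A C..B C} \<inter> {A D..B D} \<longrightarrow> \<Phi> C x < \<Phi> D x)"
            using proper[OF CDF CD(3), of "s + \<sigma> * t"] rng'[OF CD(1,4,5)] rng'[OF CD(2,4,6)] CD(7) by blast
          have mem_rng: "s + \<sigma> * x \<in> {A C..B C} \<inter> {A D..B D}" if "0 \<le> x" "x \<le> r C" "x \<le> r D" for x
            using rng[OF CD(1), of x] rng[OF CD(2), of x] that by simp
          have before: "0 \<le> x \<and> x \<le> r C \<and> x \<le> r D" if "0 \<le> x" "x < t" for x using that CD by simp
          from \<sigma> show ?thesis
          proof
            assume 1: "\<sigma> = 1"
            show ?thesis
              by (rule exI[of _ e], rule conjI[OF \<open>e > 0\<close>], rule disjE[OF e])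
                (use mem_rng before CD(4) in \<open>auto simp: 1\<close>)
          next
            assume 2: "\<sigma> = -1"
            show ?thesis
              by (rule exI[of _ e], rule conjI[OF \<open>e > 0\<close>], rule disjE[OF e])
                (use mem_rng before CD(4) in \<open>auto simp: 2\<close>)
          qed
        qed
      qed
      show "\<forall>K\<subseteq>G. pairwise_adjacent (adj (\<lambda>C t. \<Phi> C (s + \<sigma> * t)) r) K \<longrightarrow> card K \<le> k"
      proof (intro allI impI)
        fix K assume K: "K \<subseteq> G" "pairwise_adjacent (adj (\<lambda>C t. \<Phi> C (s + \<sigma> * t)) r) K"
        have "crosses C D" if CD: "C \<in> K" "D \<in> K" "C \<noteq> D" for C D
        proof -
          have "adj (\<lambda>C t. \<Phi> C (s + \<sigma> * t)) r C D"
            using K(2)[unfolded pairwise_adjacent_def, rule_format, OF CD] .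
          then obtain t where t: "0 \<le> t" "t \<le> r C" "t \<le> r D" "\<Phi> C (s + \<sigma> * t) = \<Phi> D (s + \<sigma> * t)"
            unfolding adj_def by blast
          have CDG: "C \<in> G" "D \<in> G" using CD K(1) by blast+
          show ?thesis
            by (rule crossesI[of C D "s + \<sigma> * t"]) (use CDG G CD t rng[OF CDG(1) t(1,2)] rng[OF CDG(2) t(1,3)] in auto)
        qed
        then show "card K \<le> k" using cl[of K] K(1) G unfolding pairwise_adjacent_def by blast
      qed
    qed
    let ?E = "\<lambda>\<sigma>. adj (\<lambda>C t. \<Phi> C (s + \<sigma> * t)) (\<lambda>C. if \<sigma> = 1 then B C - s else s - A C)"
    have "colorable (?E 1) G c0" by (rule side) auto
    then show "colorable crosses G (c0 * c0)"
    proof (rule colorable_product)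
      fix H assume H: "H \<subseteq> G" and nadj: "\<And>C D. \<lbrakk>C \<in> H; D \<in> H\<rbrakk> \<Longrightarrow> \<not> ?E 1 C D"
      have "colorable (?E (-1)) G c0" by (rule side) auto
      then show "colorable crosses H c0"
      proof (rule colorable_mono)
        show "?E (-1) C D" if CD: "C \<in> H" "D \<in> H" "crosses C D" for C D
        proof -
          have CDF: "C \<in> F" "D \<in> F" using CD H G by blast+
          obtain x y where "(x, y) \<in> C" "(x, y) \<in> D" using CD(3) unfolding crosses_def by auto
          then have x: "A C \<le> x" "x \<le> B C" "A D \<le> x" "x \<le> B D" "\<Phi> C x = \<Phi> D x" using mem CDF by auto
          have "C \<noteq> D" using CD(3) by (simp add: crosses_def)
          have "\<not> s \<le> x"
          proof
            assume "s \<le> x"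
            then have "?E 1 C D" unfolding adj_def using x \<open>C \<noteq> D\<close> by (auto intro!: exI[of _ "x - s"])
            then show False using nadj CD by blast
          qed
          then show ?thesis unfolding adj_def using x \<open>C \<noteq> D\<close> by (auto intro!: exI[of _ "s - x"])
        qed
      qed (use H in auto)
    qed
  qed
qed

section \<open>Divide and conquer\<close>

text \<open>Take the largest value of \<open>R\<close> with fewer than \<open>m\<close> members
  below it. The next larger value, if any, has at least \<open>m\<close> members below it, which
  leaves fewer than \<open>m\<close> of the fewer than \<open>2 * m\<close> members.\<close>

lemma ex_median:
  fixes R :: "'a \<Rightarrow> real"
  assumes "finite F" "F \<noteq> {}" "card F < 2 * m"
  shows "\<exists>s. card {C \<in> F. R C < s} < m \<and> card {C \<in> F. s < R C} < m"
proof -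
  let ?S = "{v \<in> R ` F. card {C \<in> F. R C < v} < m}"
  have "Min (R ` F) \<in> ?S"
  proof -
    have "{C \<in> F. R C < Min (R ` F)} = {}" using assms(1) by (auto simp: not_less)
    then have "card {C \<in> F. R C < Min (R ` F)} = 0" by (simp only: card.empty)
    moreover have "m > 0" using assms(3) by simp
    moreover have "Min (R ` F) \<in> R ` F" using assms(1,2) by simp
    ultimately show ?thesis by (simp only: mem_Collect_eq simp_thms)
  qed
  moreover have fin: "finite ?S" using assms(1) by simp
  ultimately have "Max ?S \<in> ?S" by (intro Max_in) auto
  then obtain s where s: "s \<in> ?S" "\<And>v. v \<in> ?S \<Longrightarrow> v \<le> s" using Max_ge[OF fin] by blast
  have "card {C \<in> F. s < R C} < m"
  proof (cases "{C \<in> F. s < R C} = {}")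
    case True
    show ?thesis unfolding True using assms(3) by simp
  next
    case False
    moreover have "finite {C \<in> F. s < R C}" using assms(1) by simp
    ultimately obtain C where C: "C \<in> {C \<in> F. s < R C}" "\<And>D. D \<in> {C \<in> F. s < R C} \<Longrightarrow> R C \<le> R D"
      using ex_min_image[of "{C \<in> F. s < R C}" R] by blast
    have "R C \<notin> ?S" using s(2)[of "R C"] C(1) by force
    then have m: "m \<le> card {D \<in> F. R D < R C}" using C(1) by simp
    have "{D \<in> F. R D < R C} \<inter> {C \<in> F. s < R C} = {}" using C(2) by force
    then have "card {D \<in> F. R D < R C} + card {C \<in> F. s < R C} = card ({D \<in> F. R D < R C} \<union> {C \<in> F. s < R C})"
      using assms(1) by (intro card_Un_disjoint[symmetric]) simp_all
    also have "\<dots> \<le> card F" using assms(1) by (intro card_mono) auto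
    finally show ?thesis using m assms(3) by linarith
  qed
  then show ?thesis using s(1) by blast
qed

lemma x_range:
  assumes "x_monotone_curve C"
  shows "\<exists>a b. a \<le> b \<and> (\<forall>x. (\<exists>y. (x, y) \<in> C) \<longleftrightarrow> a \<le> x \<and> x \<le> b)"
proof -
  obtain a b \<phi> where "a \<le> b" and C: "C = (\<lambda>x. (x, \<phi> x)) ` {a..b}"
    using x_monotone_curve_graph[OF assms] by blast
  moreover have "\<forall>x. (\<exists>y. (x, y) \<in> C) \<longleftrightarrow> a \<le> x \<and> x \<le> b" unfolding C by (auto simp: image_iff)
  ultimately show ?thesis by blast
qed

text \<open>Curves strictly left and strictly right of a median line share a palette, so halving the
  family costs only the \<open>c\<close> colors for the curves through the line.\<close>

lemma colorable_crosses_log: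
  assumes line: "\<And>F s. \<lbrakk>F \<subseteq> F0; \<And>C. C \<in> F \<Longrightarrow> \<exists>y. (s, y) \<in> C\<rbrakk> \<Longrightarrow> colorable crosses F c"
    and F0: "finite F0" "\<And>C. C \<in> F0 \<Longrightarrow> x_monotone_curve C"
  shows "F \<subseteq> F0 \<Longrightarrow> card F < 2 ^ j \<Longrightarrow> colorable crosses F (j * c)"
proof (induction j arbitrary: F)
  case 0
  then have "F = {}" using F0(1) finite_subset by fastforce
  then show ?case by simp
next
  case (Suc j)
  show ?case
  proof (cases "F = {}")
    case False
    have "\<forall>C\<in>F0. \<exists>a b. a \<le> b \<and> (\<forall>x. (\<exists>y. (x, y) \<in> C) \<longleftrightarrow> a \<le> x \<and> x \<le> b)"
      using x_range F0(2) by blast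
    from bchoice[OF this] obtain A where "\<forall>C\<in>F0. \<exists>b. A C \<le> b \<and> (\<forall>x. (\<exists>y. (x, y) \<in> C) \<longleftrightarrow> A C \<le> x \<and> x \<le> b)" ..
    from bchoice[OF this] obtain B where
      *: "\<forall>C\<in>F0. A C \<le> B C \<and> (\<forall>x. (\<exists>y. (x, y) \<in> C) \<longleftrightarrow> A C \<le> x \<and> x \<le> B C)" ..
    have AB: "(\<exists>y. (x, y) \<in> C) \<longleftrightarrow> A C \<le> x \<and> x \<le> B C" and AleB: "A C \<le> B C" if "C \<in> F0" for C x
      using bspec[OF * that] by blast+
    have fin: "finite F" using Suc.prems(1) F0(1) finite_subset by blast
    \<comment> \<open>The median of the right endpoints works for both sides: a curve that starts to
      the right of the line also ends there.\<close>
    obtain s where s: "card {C \<in> F. B C < s} < 2 ^ j" "card {C \<in> F. s < B C} < 2 ^ j"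
      using ex_median[OF fin False, of "2 ^ j" B] Suc.prems(2) by auto
    let ?L = "{C \<in> F. B C < s}" and ?R = "{C \<in> F. s < A C}"
    have "card ?R \<le> card {C \<in> F. s < B C}"
      using fin AleB Suc.prems(1) by (intro card_mono) force+
    then have "card ?R < 2 ^ j" using s(2) by simp
    have LR: "colorable crosses (?L \<union> ?R) (j * c)"
    proof (rule colorable_fibres[where p = "\<lambda>C. B C < s"])
      fix C D assume CD: "C \<in> ?L \<union> ?R" "D \<in> ?L \<union> ?R" "crosses C D"
      then obtain x y where "(x, y) \<in> C" "(x, y) \<in> D" unfolding crosses_def by auto
      then have "A C \<le> x" "x \<le> B C" "A D \<le> x" "x \<le> B D" using AB CD(1,2) Suc.prems(1) by blast+
      then show "(B C < s) = (B D < s)" using CD(1,2) by auto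
    next
      fix p
      show "colorable crosses {C \<in> ?L \<union> ?R. (B C < s) = p} (j * c)"
      proof (cases p)
        case True
        have "colorable crosses ?L (j * c)" by (rule Suc.IH) (use Suc.prems(1) s in auto)
        then show ?thesis by (rule colorable_subset) (use True in auto)
      next
        case False
        have "colorable crosses ?R (j * c)" by (rule Suc.IH) (use Suc.prems(1) \<open>card ?R < 2 ^ j\<close> in auto)
        then show ?thesis by (rule colorable_subset) (use False in auto)
      qed
    qed
    have "colorable crosses (F - (?L \<union> ?R)) c"
    proof (rule line)
      show "\<exists>y. (s, y) \<in> C" if "C \<in> F - (?L \<union> ?R)" for C using AB[of C s] that Suc.prems(1) by auto
    qed (use Suc.prems(1) in blast)
    from colorable_Un[OF this LR] have "colorable crosses (F - (?L \<union> ?R) \<union> (?L \<union> ?R)) (Suc j * c)" by simp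
    then show ?thesis by (rule colorable_subset) blast
  qed simp
qed

theorem theorem1p4:
  fixes k :: nat
  shows "\<exists>c::real. \<forall>(n::nat) (F :: plane set set).
           n \<ge> 2 \<longrightarrow> finite F \<longrightarrow> card F = n \<longrightarrow>
           (\<forall>C\<in>F. x_monotone_curve C) \<longrightarrow>
           simple_family F \<longrightarrow>
           \<not> (\<exists>K\<subseteq>F. card K = k \<and> clique K (intersection_edges F)) \<longrightarrow>
           real (chromatic_number F (intersection_edges F)) \<le> c * ln (real n)"
proof -
  obtain c0 where c0: "\<And>(V :: plane set set) f r. \<lbrakk>flags V f r;
      \<forall>K\<subseteq>V. pairwise_adjacent (adj f r) K \<longrightarrow> card K \<le> k\<rbrakk> \<Longrightarrow> colorable (adj f r) V c0"
    using flags_chi_bounded[of k] by blast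
  define c where "c = k * (c0 * c0)"
  \<comment> \<open>The halving depth is \<open>Suc j\<close> with \<open>2 ^ j \<le> n\<close>.
    Both \<open>j\<close> and 1 are at most \<open>ln n / ln 2\<close>, the latter because
    \<open>n \<ge> 2\<close>; hence the factor 2.\<close>
  have "real (chromatic_number F (intersection_edges F)) \<le> 2 * real c / ln 2 * ln (real n)"
    if n: "n \<ge> 2" and F: "finite F" "card F = n" "\<forall>C\<in>F. x_monotone_curve C" "simple_family F"
      and nocl: "\<not> (\<exists>K\<subseteq>F. card K = k \<and> clique K (intersection_edges F))" for n and F :: "plane set set"
  proof -
    have edge: "{C, D} \<in> intersection_edges F" if "C \<in> F" "D \<in> F" "crosses C D" for C D
      using that unfolding intersection_edges_def crosses_def by blast
    have cl: "card K \<le> k" if K: "K \<subseteq> F" "pairwise_adjacent crosses K" for K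
    proof (rule ccontr)
      assume "\<not> card K \<le> k"
      then obtain L where L: "L \<subseteq> K" "card L = k" by (meson nat_le_linear obtain_subset_with_card_n)
      have "clique L (intersection_edges F)"
        unfolding clique_def using L(1) K edge unfolding pairwise_adjacent_def by blast
      then show False using nocl L K(1) by blast
    qed
    obtain j where j: "2 ^ j \<le> n" "n < 2 ^ (j + 1)" using ex_power_ivl1[of 2 n] n by auto
    have "colorable crosses F (Suc j * c)"
    proof (rule colorable_crosses_log)
      fix G s assume G: "G \<subseteq> F" "\<And>C. C \<in> G \<Longrightarrow> \<exists>y. (s, y) \<in> C"
      show "colorable crosses G c"
        unfolding c_def
      proof (rule colorable_through_common_line[OF c0])
        show "finite G" using F(1) G(1) finite_subset by blast
        show "simple_family G" using F(4) G(1) unfolding simple_family_def by (rule pairwise_subset)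
        show "x_monotone_curve C" if "C \<in> G" for C using F(3) G(1) that by blast
        show "card K \<le> k" if "K \<subseteq> G" "pairwise_adjacent crosses K" for K using cl[of K] G(1) that by blast
        show "\<exists>y. (s, y) \<in> C" if "C \<in> G" for C using G(2)[OF that] .
      qed
    qed (use F j in auto)
    then obtain h where h: "\<And>C. C \<in> F \<Longrightarrow> h C < Suc j * c"
      "\<And>C D. \<lbrakk>C \<in> F; D \<in> F; crosses C D\<rbrakk> \<Longrightarrow> h C \<noteq> h D"
      unfolding colorable_def by blast
    have "proper_coloring F (intersection_edges F) (Suc j * c) h"
      unfolding proper_coloring_def
    proof (intro conjI ballI impI)
      show "h ` F \<subseteq> {..<Suc j * c}" using h(1) by auto
      fix C D assume CD: "C \<in> F" "D \<in> F" "{C, D} \<in> intersection_edges F \<and> C \<noteq> D"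
      then have "crosses C D" unfolding intersection_edges_def crosses_def by (auto simp: doubleton_eq_iff)
      then show "h C \<noteq> h D" using h(2) CD by blast
    qed
    then have "chromatic_number F (intersection_edges F) \<le> Suc j * c"
      unfolding chromatic_number_def by (intro Least_le) blast
    then have "real (chromatic_number F (intersection_edges F)) \<le> real (Suc j) * real c"
      by (metis of_nat_le_iff of_nat_mult)
    also have "real (Suc j) \<le> 2 * ln (real n) / ln 2"
    proof -
      have "ln (2 ^ j) \<le> ln (real n)" using j(1) n by (subst ln_le_cancel_iff) (auto simp: numeral_power_le_of_nat_cancel_iff)
      then have "real j * ln 2 \<le> ln (real n)" by (simp add: ln_realpow)
      moreover have "ln 2 \<le> ln (real n)" using n by simp
      ultimately have "real (Suc j) * ln 2 \<le> 2 * ln (real n)" by (simp add: algebra_simps)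
      then show ?thesis by (simp add: pos_le_divide_eq)
    qed
    then have "real (Suc j) * real c \<le> 2 * ln (real n) / ln 2 * real c" by (rule mult_right_mono) simp
    finally show ?thesis by (simp add: mult_ac)
  qed
  then show ?thesis by blast
qed

end
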